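(* The volume function $\mathrm{vol}:S\to\mathbb R$ is given by $$\mathrm{vol}(\alpha,\omega)=\begin{cases}\Lambda(\theta_1)+\Lambda(\theta_2)+\Lambda(\theta_3),&(\alpha,\omega)\neq\left(0,\tfrac12\right)\\ 0,&(\alpha,\omega)=\left(0,\tfrac12\right),\end{cases}$$ where $$\theta_1:=\arccos\frac{-r^2+s^2+t^2}{2st},\quad\theta_2:=\arccos\frac{r^2-s^2+t^2}{2rt},\quad\theta_3:=\arccos\frac{r^2+s^2-t^2}{2rs},$$ $$(r,s,t):=\left(\frac{1-\sqrt3\,d}{3},\ \frac{2-3c+\sqrt3\,d}{6},\ \frac{2+3c+\sqrt3\,d}{6}\right),$$ and $$(c,d):=\begin{cases}(0,0),&(\alpha,\omega)=\left(-\tfrac1{27},\tfrac13\right)\\ \sqrt{2\omega-\tfrac23}\cdot(\sin\kappa,\cos\kappa),&(\alpha,\omega)\neq\left(-\tfrac1{27},\tfrac13\right),\end{cases}\qquad\kappa:=\frac13\arccos\frac{-27\alpha+18\omega-7}{4\sqrt2\,(3\omega-1)^{3/2}}.$$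
   Context: $\Lambda:\mathbb R\to\mathbb R$ is the Lobachevsky function $\Lambda(\theta):=-\int_0^\theta\log|2\sin u|\,du$. Let $V$ be a $4$-dimensional real vector space with a symmetric bilinear form $\langle-,-\rangle$ of signature $---+$. Hyperbolic $3$-space is $\{\boldsymbol p\in\mathbb PV\mid\langle p,p\rangle>0\}$ with its hyperbolic metric (curvature $-1$); points $\boldsymbol p\in\mathbb PV$ with $\langle p,p\rangle=0$ are ideal points ($p\in V$ denotes a representative of $\boldsymbol p$). A labelled ideal tetrahedron is a $4$-tuple $(\boldsymbol v_1,\boldsymbol v_2,\boldsymbol v_3,\boldsymbol v_4)$ of ideal points; its volume is the hyperbolic volume of the convex hull of its vertices. A Gram matrix of it is $[\langle v_i,v_j\rangle]$ for some representatives $v_i\in V$. A square matrix is doubly stochastic if its entries are non-negative and each row and column sums to $1$. Only tetrahedra admitting a doubly stochastic Gram matrix are considered; such a matrix is then unique. Let $\Delta:=\{(x,y,z)\in\mathbb R^3\mid x+y+z=1,\ x\le y+z,\ y\le z+x,\ z\le x+y\}$. The set of labelled ideal tetrahedra admitting a doubly stochastic Gram matrix, modulo isometries preserving the order of vertices, is identified with $\Delta$: $T=(x,y,z)\in\Delta$ corresponds to the doubly stochastic Gram matrix $$G_T=\begin{pmatrix}0&x&y&z\\ x&0&z&y\\ y&z&0&x\\ z&y&x&0\end{pmatrix}.$$ Put $S:=\{(\det G_T,\sqrt{\operatorname{per}G_T})\mid T\in\Delta\}\subset\mathbb R^2$, where $\operatorname{per}A:=\sum_{\sigma\in S_m}a_{1\sigma(1)}\cdots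 a_{m\sigma(m)}$ is the permanent of an $m\times m$ matrix $A=[a_{ij}]$. For $(\alpha,\omega)\in S$, $\mathrm{vol}(\alpha,\omega)$ denotes the volume of any tetrahedron $T\in\Delta$ with $\det G_T=\alpha$ and $\sqrt{\operatorname{per}G_T}=\omega$ (the volume does not depend on the choice of such $T$). *)

theory Defs
  imports "HOL-Analysis.Analysis"
begin

definition lobachevsky :: "real \<Rightarrow> real" where
  "lobachevsky \<theta> = - (LBINT u=ereal 0..ereal \<theta>. ln \<bar>2 * sin u\<bar>)"

definition permanent :: "'a::comm_ring_1^'n^'n \<Rightarrow> 'a" where
  "permanent A = (\<Sum>p | p permutes (UNIV :: 'n set). \<Prod>i\<in>UNIV. A $ i $ p i)"

definition doubly_stochastic :: "real^'n^'n \<Rightarrow> bool" where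
  "doubly_stochastic A \<longleftrightarrow> (\<forall>i j. 0 \<le> A $ i $ j) \<and>
     (\<forall>i. (\<Sum>j\<in>UNIV. A $ i $ j) = 1) \<and> (\<forall>j. (\<Sum>i\<in>UNIV. A $ i $ j) = 1)"


text \<open>A basis \<open>f 1, f 2, f 3, n\<close> that is orthonormal for a form of signature \<open>---+\<close>; by
  definition of the signature, such a basis exists.\<close>

definition orthonormal_frame :: "('v::real_vector \<Rightarrow> 'v \<Rightarrow> real) \<Rightarrow> (3 \<Rightarrow> 'v) \<Rightarrow> 'v \<Rightarrow> bool" where
  "orthonormal_frame B f n \<longleftrightarrow>
     (\<forall>i j. B (f i) (f j) = (if i = j then -1 else 0)) \<and>
     (\<forall>i. B (f i) n = 0) \<and> B n n = 1 \<and> span (insert n (range f)) = UNIV"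

definition lorentzian_form :: "('v::real_vector \<Rightarrow> 'v \<Rightarrow> real) \<Rightarrow> bool" where
  "lorentzian_form B \<longleftrightarrow> dim (UNIV :: 'v set) = 4 \<and> bilinear B \<and> (\<forall>u w. B u w = B w u) \<and>
     (\<exists>f n. orthonormal_frame B f n)"


text \<open>Points of the projective space of \<open>'v\<close> are represented by lines through the origin.\<close>

definition ideal_point :: "('v::real_vector \<Rightarrow> 'v \<Rightarrow> real) \<Rightarrow> 'v set \<Rightarrow> bool" where
  "ideal_point B P \<longleftrightarrow> (\<exists>p. p \<noteq> 0 \<and> B p p = 0 \<and> P = span {p})"

type_synonym 'v labelled_tetrahedron = "4 \<Rightarrow> 'v set"

definition ideal_tetrahedron ::
    "('v::real_vector \<Rightarrow> 'v \<Rightarrow> real) \<Rightarrow> 'v labelled_tetrahedron \<Rightarrow> bool" where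
  "ideal_tetrahedron B v \<longleftrightarrow> (\<forall>i. ideal_point B (v i))"

definition is_gram_matrix ::
    "('v::real_vector \<Rightarrow> 'v \<Rightarrow> real) \<Rightarrow> 'v labelled_tetrahedron \<Rightarrow> real^4^4 \<Rightarrow> bool" where
  "is_gram_matrix B v G \<longleftrightarrow>
     (\<exists>u. (\<forall>i. u i \<in> v i \<and> u i \<noteq> 0) \<and> (\<forall>i j. G $ i $ j = B (u i) (u j)))"


text \<open>
  The affine chart \<open>x \<mapsto> [x\<^sub>1 f\<^sub>1 + x\<^sub>2 f\<^sub>2 + x\<^sub>3 f\<^sub>3 + n]\<close> of the projective space. It covers every
  point \<open>[p]\<close> with \<open>\<langle>p,p\<rangle> \<ge> 0\<close> (hyperbolic space becomes the open unit ball, the Klein model),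
  and hyperbolic geodesics are straight segments in it. Hence the hyperbolic convex hull of points of
  the closed ball is their affine convex hull.
\<close>

definition klein_chart :: "(3 \<Rightarrow> 'v::real_vector) \<Rightarrow> 'v \<Rightarrow> real^3 \<Rightarrow> 'v" where
  "klein_chart f n x = (\<Sum>i\<in>UNIV. x $ i *\<^sub>R f i) + n"

text \<open>
  The Riemannian metric of curvature \<open>-1\<close> at \<open>[p]\<close>. The tangent space at \<open>[p]\<close> is
  \<open>Hom(\<real>p, p\<^sup>\<bottom>)\<close>, with the inner product \<open>-\<langle>\<phi> p, \<psi> p\<rangle> / \<langle>p,p\<rangle>\<close>; the vectors
  \<open>u\<close> and \<open>w\<close> stand for the velocities at \<open>t = 0\<close> of the curves \<open>[p + t u]\<close> and \<open>[p + t w]\<close>, that is,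
  for the homomorphisms sending \<open>p\<close> to the components of \<open>u\<close> and \<open>w\<close> orthogonal to \<open>p\<close>.
\<close>

definition hyperbolic_metric ::
    "('v::real_vector \<Rightarrow> 'v \<Rightarrow> real) \<Rightarrow> 'v \<Rightarrow> 'v \<Rightarrow> 'v \<Rightarrow> real" where
  "hyperbolic_metric B p u w =
     - B (u - (B u p / B p p) *\<^sub>R p) (w - (B w p / B p p) *\<^sub>R p) / B p p"

text \<open>The Riemannian volume measure of hyperbolic space, transported to the chart.\<close>

definition hyperbolic_measure ::
    "('v::real_vector \<Rightarrow> 'v \<Rightarrow> real) \<Rightarrow> (3 \<Rightarrow> 'v) \<Rightarrow> 'v \<Rightarrow> (real^3) measure" where
  "hyperbolic_measure B f n = density lborel (\<lambda>x.
     let p = klein_chart f n x in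
     if B p p > 0
     then ennreal (sqrt (det ((\<chi> i j. hyperbolic_metric B p (f i) (f j)) :: real^3^3)))
     else 0)"

definition volume_in_frame :: "('v::real_vector \<Rightarrow> 'v \<Rightarrow> real) \<Rightarrow> (3 \<Rightarrow> 'v) \<Rightarrow> 'v \<Rightarrow>
    'v labelled_tetrahedron \<Rightarrow> real" where
  "volume_in_frame B f n v =
     measure (hyperbolic_measure B f n) (convex hull {x. \<exists>i. klein_chart f n x \<in> v i})"

text \<open>
  In the next three definitions \<open>THE\<close> singles out the common value over all admissible choices (of an
  orthonormal frame, of a tetrahedron in its isometry class, of a class with the given determinant
  and permanent). If the choices gave different values, or if there were none, the description would
  be unspecified.
\<close>

definition tetrahedron_volume ::
    "('v::real_vector \<Rightarrow> 'v \<Rightarrow> real) \<Rightarrow> 'v labelled_tetrahedron \<Rightarrow> real" where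
  "tetrahedron_volume B v = (THE V. \<forall>f n. orthonormal_frame B f n \<longrightarrow> volume_in_frame B f n v = V)"


definition Delta :: "(real \<times> real \<times> real) set" where
  "Delta = {(x, y, z). x + y + z = 1 \<and> x \<le> y + z \<and> y \<le> z + x \<and> z \<le> x + y}"

fun gram :: "real \<times> real \<times> real \<Rightarrow> real^4^4" where
  "gram (x, y, z) = vector
     [vector [0, x, y, z],
      vector [x, 0, z, y],
      vector [y, z, 0, x],
      vector [z, y, x, 0]]"

definition represents :: "('v::real_vector \<Rightarrow> 'v \<Rightarrow> real) \<Rightarrow> real \<times> real \<times> real \<Rightarrow>
    'v labelled_tetrahedron \<Rightarrow> bool" where
  "represents B T v \<longleftrightarrow>
     ideal_tetrahedron B v \<and> is_gram_matrix B v (gram T) \<and> doubly_stochastic (gram T)"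

definition class_volume ::
    "('v::real_vector \<Rightarrow> 'v \<Rightarrow> real) \<Rightarrow> real \<times> real \<times> real \<Rightarrow> real" where
  "class_volume B T = (THE V. \<forall>v. represents B T v \<longrightarrow> tetrahedron_volume B v = V)"

definition S :: "(real \<times> real) set" where
  "S = (\<lambda>T. (det (gram T), sqrt (permanent (gram T)))) ` Delta"

definition vol :: "('v::real_vector \<Rightarrow> 'v \<Rightarrow> real) \<Rightarrow> real \<Rightarrow> real \<Rightarrow> real" where
  "vol B \<alpha> \<omega> = (THE V. \<forall>T\<in>Delta.
     det (gram T) = \<alpha> \<and> sqrt (permanent (gram T)) = \<omega> \<longrightarrow> class_volume B T = V)"

end

theory Submission
  imports Defs "HOL-Real_Asymp.Real_Asymp"
begin

text \<open>
  In the Klein model the volume density is \<open>(1 - |x|\<^sup>2)\<^sup>-\<^sup>2\<close>. If \<open>X\<^sub>1, \<dots>, X\<^sub>4\<close> are the vertices on the unit sphere and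
  \<open>h\<^sub>i\<^sub>j = 1 - \<langle>X\<^sub>i, X\<^sub>j\<rangle>\<close>, the projective parametrisation \<open>l \<mapsto> [l\<^sub>1 X\<^sub>1 + l\<^sub>2 X\<^sub>2 + l\<^sub>3 X\<^sub>3 + X\<^sub>4]\<close> of the tetrahedron by
  the positive octant turns the volume into the integral of \<open>|D| / (4 Q\<^sup>2)\<close>, where \<open>Q\<close> is the quadratic form
  \<open>\<Sum>\<^sub>i\<^sub><\<^sub>j h\<^sub>i\<^sub>j l\<^sub>i l\<^sub>j\<close> at \<open>l\<^sub>4 = 1\<close> and \<open>D\<^sup>2 = - det h\<close>. Rescaling the \<open>l\<^sub>i\<close> shows that only the three products
  \<open>h\<^sub>1\<^sub>2 h\<^sub>3\<^sub>4\<close>, \<open>h\<^sub>1\<^sub>3 h\<^sub>2\<^sub>4\<close>, \<open>h\<^sub>1\<^sub>4 h\<^sub>2\<^sub>3\<close> matter; up to a common factor they are \<open>x\<^sup>2, y\<^sup>2, z\<^sup>2\<close>. Two of the three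
  integrations are elementary, and in the third one the angle between a side and a varying partial side of
  the Euclidean triangle with sides \<open>x, y, z\<close> is the right variable: the integrand becomes a
  combination of functions \<open>ln (2 sin u)\<close>, and the volume is \<open>\<Lambda>(A) + \<Lambda>(B) + \<Lambda>(C)\<close> for the angles of that triangle.

  Since \<open>det G\<^sub>T = -(1 - 2x)(1 - 2y)(1 - 2z)\<close> and \<open>per G\<^sub>T = (x\<^sup>2 + y\<^sup>2 + z\<^sup>2)\<^sup>2\<close>, the pair \<open>(\<alpha>, \<omega>)\<close> determines the
  elementary symmetric functions of \<open>x, y, z\<close>; the trigonometric solution of the cubic returns \<open>r \<le> s \<le> t\<close>.
\<close>

section \<open>The Lobachevsky function\<close>

text \<open>The difference vanishes at 0 and has derivative \<open>u * sin u\<close>, which is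
  nonnegative up to pi. Read as \<open>u * cot u <= 1\<close>, it controls the logarithmic
  singularity below.\<close>

lemma sin_ge_mult_cos:
  fixes u :: real
  assumes "0 \<le> u" "u \<le> pi"
  shows "u * cos u \<le> sin u"
proof -
  have "(\<lambda>u. sin u - u * cos u) 0 \<le> (\<lambda>u. sin u - u * cos u) u"
  proof (rule DERIV_nonneg_imp_nondecreasing[OF assms(1)])
    fix x assume x: "0 \<le> x" "x \<le> u"
    have "((\<lambda>u. sin u - u * cos u) has_real_derivative x * sin x) (at x)"
      by (auto intro!: derivative_eq_intros)
    moreover have "0 \<le> x * sin x"
      using x assms by (intro mult_nonneg_nonneg sin_ge_zero) auto
    ultimately show "\<exists>y. ((\<lambda>u. sin u - u * cos u) has_real_derivative y) (at x) \<and> 0 \<le> y"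
      by blast
  qed
  then show ?thesis by simp
qed

text \<open>The derivative of \<open>u - u * ln (sin u)\<close> is the sum of the nonnegative terms
  \<open>- ln (sin u)\<close> and \<open>1 - u * cot u\<close>. The primitive has finite limits at
  both ends, so this derivative is integrable, and it dominates \<open>ln (sin u)\<close>.\<close>

lemma set_integrable_ln_sin_left: "set_integrable lborel {0<..<pi/2} (\<lambda>u. ln (sin u))"
proof -
  let ?F = "\<lambda>u::real. u - u * ln (sin u)"
  let ?f = "\<lambda>u::real. 1 - ln (sin u) - u * (cos u / sin u)"
  have pos: "sin u > 0" if "0 < u" "u < pi/2" for u :: real
    using that by (intro sin_gt_zero) auto
  have le: "u * (cos u / sin u) \<le> 1" if "0 < u" "u < pi/2" for u :: real
    using sin_ge_mult_cos[of u] pos[of u] that by (simp add: field_simps)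
  have "set_integrable lborel (einterval (ereal 0) (ereal (pi/2))) ?f"
  proof (rule interval_integral_FTC_nonneg(1))
    show "DERIV ?F x :> ?f x" if "ereal 0 < ereal x" "ereal x < ereal (pi/2)" for x
      using that pos[of x] by (auto intro!: derivative_eq_intros simp: field_simps)
    show "isCont ?f x" if "ereal 0 < ereal x" "ereal x < ereal (pi/2)" for x
      using that pos[of x] by (auto intro!: continuous_intros)
    have "?f x \<ge> 0" if "0 < x" "x < pi/2" for x
      using le[OF that] ln_le_zero_iff[OF pos[OF that]] sin_le_one[of x] by linarith
    then show "AE x in lborel. ereal 0 < ereal x \<longrightarrow> ereal x < ereal (pi/2) \<longrightarrow> 0 \<le> ?f x"
      by auto
    have "(?F \<longlongrightarrow> 0) (at_right 0)"
      by real_asymp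
    then show "((?F \<circ> real_of_ereal) \<longlongrightarrow> 0) (at_right (ereal 0))"
      by (simp add: ereal_tendsto_simps)
    have "isCont ?F (pi/2)"
      by (intro continuous_intros) auto
    then have "(?F \<longlongrightarrow> ?F (pi/2)) (at_left (pi/2))"
      unfolding isCont_def by (rule tendsto_mono[rotated]) (simp add: at_within_le_at)
    then show "((?F \<circ> real_of_ereal) \<longlongrightarrow> ?F (pi/2)) (at_left (ereal (pi/2)))"
      by (simp add: ereal_tendsto_simps)
  qed simp
  then have f: "set_integrable lborel {0<..<pi/2} ?f"
    by simp
  show ?thesis
  proof (rule set_integrable_bound[OF f])
    show "set_borel_measurable lborel {0<..<pi/2} (\<lambda>u. ln (sin u))"
      unfolding set_borel_measurable_def by measurable
    show "AE x in lborel. x \<in> {0<..<pi/2} \<longrightarrow> norm (ln (sin x)) \<le> norm (?f x)"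
    proof (intro AE_I2 impI)
      fix x :: real assume x: "x \<in> {0<..<pi/2}"
      then have "ln (sin x) \<le> 0"
        using pos[of x] by simp
      then show "norm (ln (sin x)) \<le> norm (?f x)"
        using le[of x] x by simp
    qed
  qed
qed

text \<open>The half beyond pi/2 is the mirror image of the first half under
  \<open>u \<mapsto> pi - u\<close>; the points 0, pi/2 and pi form a null set.\<close>

lemma set_integrable_ln_2_sin: "set_integrable lborel {0..pi} (\<lambda>u. ln \<bar>2 * sin u\<bar>)"
proof -
  let ?g = "\<lambda>u::real. indicator {0<..<pi/2} u *\<^sub>R ln (sin u)"
  have "integrable lborel ?g"
    using set_integrable_ln_sin_left by (simp add: set_integrable_def)
  from lborel_integrable_real_affine[OF this, of "-1" pi]
  have g': "integrable lborel (\<lambda>u. ?g (pi - u))"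
    by simp
  have "integrable lborel (\<lambda>u. indicator {0<..<pi} u *\<^sub>R ln 2 + ?g u + ?g (pi - u))"
    using \<open>integrable lborel ?g\<close> g'
    by (intro Bochner_Integration.integrable_add integrable_real_indicator
          integrable_scaleR_left) auto
  then have "integrable lborel (\<lambda>u. indicator {0..pi} u *\<^sub>R ln \<bar>2 * sin u\<bar>)"
  proof (rule integrable_cong_AE_imp)
    have "AE u in lborel. u \<noteq> 0 \<and> u \<noteq> pi/2 \<and> u \<noteq> pi"
      by (intro AE_conjI AE_lborel_singleton)
    then show "AE u in lborel. indicator {0<..<pi} u *\<^sub>R ln 2 + ?g u + ?g (pi - u) =
        indicator {0..pi} u *\<^sub>R ln \<bar>2 * sin u\<bar>"
    proof eventually_elim
      case (elim u)
      show ?case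
      proof (cases "0 < u \<and> u < pi")
        case True
        then have "sin u > 0" by (simp add: sin_gt_zero)
        then have "ln \<bar>2 * sin u\<bar> = ln 2 + ln (sin u)"
          by (simp add: ln_mult)
        with True elim show ?thesis
          by (auto simp: indicator_def)
      next
        case False
        with elim show ?thesis
          by (auto simp: indicator_def not_less le_less)
      qed
    qed
  qed measurable
  then show ?thesis
    by (simp add: set_integrable_def)
qed

lemma lobachevsky_eq_integral:
  assumes "\<theta> \<in> {0..pi}"
  shows "lobachevsky \<theta> = - integral {0..\<theta>} (\<lambda>u. ln \<bar>2 * sin u\<bar>)"
  unfolding lobachevsky_def
  using assms
  by (subst interval_integral_eq_integral)
    (auto intro: set_integrable_subset[OF set_integrable_ln_2_sin])

lemma lobachevsky_0 [simp]: "lobachevsky 0 = 0"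
  by (simp add: lobachevsky_eq_integral)

text \<open>Continuity reaches the endpoints, where the integrand is singular. Identities can
  therefore be proved by differentiating in the open interval alone.\<close>

lemma continuous_on_lobachevsky: "continuous_on {0..pi} lobachevsky"
proof -
  have "continuous_on {0..pi} (\<lambda>\<theta>. - integral {0..\<theta>} (\<lambda>u. ln \<bar>2 * sin u\<bar>))"
    using set_borel_integral_eq_integral(1)[OF set_integrable_ln_2_sin]
    by (intro continuous_on_minus indefinite_integral_continuous_1)
  then show ?thesis
    by (rule continuous_on_eq) (simp add: lobachevsky_eq_integral)
qed

lemma DERIV_lobachevsky:
  assumes "0 < \<theta>" "\<theta> < pi"
  shows "(lobachevsky has_real_derivative - ln (2 * sin \<theta>)) (at \<theta>)"
proof -
  have s: "sin \<theta> > 0" using assms by (simp add: sin_gt_zero)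
  have "((\<lambda>u. integral {0..u} (\<lambda>u. ln \<bar>2 * sin u\<bar>)) has_vector_derivative ln \<bar>2 * sin \<theta>\<bar>)
      (at \<theta> within ({0..pi} - {}))"
    using assms s set_borel_integral_eq_integral(1)[OF set_integrable_ln_2_sin]
    by (intro integral_has_vector_derivative_continuous_at continuous_intros) auto
  then have "((\<lambda>u. integral {0..u} (\<lambda>u. ln \<bar>2 * sin u\<bar>)) has_real_derivative ln (2 * sin \<theta>))
      (at \<theta> within {0..pi})"
    using s by (simp add: has_real_derivative_iff_has_vector_derivative abs_mult)
  then have "((\<lambda>u. integral {0..u} (\<lambda>u. ln \<bar>2 * sin u\<bar>)) has_real_derivative ln (2 * sin \<theta>))
      (at \<theta>)"
    using assms at_within_Icc_at[of 0 \<theta> pi] by simp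
  then have "((\<lambda>u. - integral {0..u} (\<lambda>u. ln \<bar>2 * sin u\<bar>)) has_real_derivative - ln (2 * sin \<theta>))
      (at \<theta>)"
    by (rule DERIV_minus)
  then show ?thesis
    by (rule has_field_derivative_transform_within_open[where S = "{0<..<pi}"])
      (use assms in \<open>auto simp: lobachevsky_eq_integral\<close>)
qed

lemmas DERIV_lobachevsky_chain [derivative_intros] = DERIV_chain2[OF DERIV_lobachevsky]

lemma continuous_on_lobachevsky_compose [continuous_intros]:
  assumes "continuous_on A f" "\<And>x. x \<in> A \<Longrightarrow> f x \<in> {0..pi}"
  shows "continuous_on A (\<lambda>x. lobachevsky (f x))"
  using continuous_on_compose2[OF continuous_on_lobachevsky assms(1)] assms(2) by blast

text \<open>The duplication identity \<open>\<Lambda>(2t) = 2\<Lambda>(t) - 2\<Lambda>(\<pi>/2 - t) + 2\<Lambda>(\<pi>/2)\<close>, read at \<open>t = \<pi>/4\<close> and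
  \<open>t = \<pi>/2\<close>, gives \<open>\<Lambda>(\<pi>/2) = 0\<close> and \<open>\<Lambda>(\<pi>) = 0\<close>.\<close>

lemma lobachevsky_pi [simp]: "lobachevsky pi = 0"
proof -
  let ?h = "\<lambda>t. lobachevsky (2 * t) - 2 * lobachevsky t + 2 * lobachevsky (pi/2 - t)"
  have "?h b = ?h 0" if "0 < b" "b \<le> pi/2" for b
  proof (rule DERIV_isconst_end[of 0 b ?h])
    show "continuous_on {0..b} ?h"
      using that by (intro continuous_intros) auto
    show "(?h has_real_derivative 0) (at t)" if t: "0 < t" "t < b" for t
    proof -
      have "sin t > 0" "cos t > 0"
        using t \<open>b \<le> pi/2\<close> by (auto intro!: sin_gt_zero cos_gt_zero)
      moreover have "2 * sin (2 * t) = (2 * sin t) * (2 * cos t)"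
        by (simp add: sin_double)
      ultimately have "ln (2 * sin (2 * t)) = ln (2 * sin t) + ln (2 * cos t)"
        using ln_mult_pos[of "2 * sin t" "2 * cos t"] by (simp add: mult_ac)
      then show ?thesis
        using t \<open>b \<le> pi/2\<close>
        by (auto intro!: derivative_eq_intros simp: sin_diff)
    qed
  qed (use that in auto)
  from this[of "pi/4"] this[of "pi/2"] show ?thesis
    by simp
qed

text \<open>Since \<open>sin (pi - t) = sin t\<close>, the sum of
  \<open>lobachevsky (pi - t)\<close> and \<open>lobachevsky t\<close> is constant, and it starts
  from \<open>lobachevsky pi = 0\<close>.\<close>

lemma lobachevsky_pi_minus:
  assumes "0 \<le> \<theta>" "\<theta> \<le> pi"
  shows "lobachevsky (pi - \<theta>) = - lobachevsky \<theta>"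
proof (cases "\<theta> = 0")
  case False
  let ?h = "\<lambda>t. lobachevsky (pi - t) + lobachevsky t"
  have "?h \<theta> = ?h 0"
  proof (rule DERIV_isconst_end[of 0 \<theta> ?h])
    show "continuous_on {0..\<theta>} ?h"
      using assms by (intro continuous_intros) auto
    show "(?h has_real_derivative 0) (at t)" if t: "0 < t" "t < \<theta>" for t
      using t assms by (auto intro!: derivative_eq_intros)
  qed (use assms False in auto)
  then show ?thesis by simp
qed simp

section \<open>The integral over a Euclidean triangle\<close>

text \<open>The inequality \<open>A \<le> B\<close> is part of the conclusion because
  \<open>ennreal\<close> truncates negative numbers, so the equation alone would not reveal
  it.\<close>

lemma nn_integral_FTC_greaterThan:
  fixes f F :: "real \<Rightarrow> real"
  assumes F: "\<And>x. 0 < x \<Longrightarrow> (F has_real_derivative f x) (at x)"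
    and f: "\<And>x. 0 < x \<Longrightarrow> isCont f x" "\<And>x. 0 < x \<Longrightarrow> 0 \<le> f x"
    and lims: "(F \<longlongrightarrow> A) (at_right 0)" "(F \<longlongrightarrow> B) at_top"
  shows "A \<le> B \<and> (\<integral>\<^sup>+x. ennreal (f x) * indicator {0<..} x \<partial>lborel) = ennreal (B - A)"
proof -
  have A: "((F \<circ> real_of_ereal) \<longlongrightarrow> A) (at_right 0)"
    using lims(1) by (simp add: ereal_tendsto_simps zero_ereal_def)
  have B: "((F \<circ> real_of_ereal) \<longlongrightarrow> B) (at_left \<infinity>)"
    using lims(2) by (simp add: ereal_tendsto_simps)
  have lt: "(0::ereal) < \<infinity>" by simp
  note FTC = interval_integral_FTC_nonneg[OF lt, of F f, OF _ _ _ A B]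
  have S: "einterval 0 \<infinity> = {0<..}"
    by (auto simp: einterval_def)
  have int: "set_integrable lborel {0<..} f"
    unfolding S[symmetric] by (rule FTC(1)) (use F f in auto)
  have eq: "(LINT x:{0<..}|lborel. f x) = B - A"
    using FTC(2) F f by (simp add: interval_lebesgue_integral_le_eq S)
  have "(\<integral>\<^sup>+x. ennreal (indicator {0<..} x *\<^sub>R f x) \<partial>lborel) = ennreal (LINT x:{0<..}|lborel. f x)"
    unfolding set_lebesgue_integral_def
    by (rule nn_integral_eq_integral)
      (use int f in \<open>auto simp: set_integrable_def indicator_def\<close>)
  also have "(\<integral>\<^sup>+x. ennreal (indicator {0<..} x *\<^sub>R f x) \<partial>lborel) =
      (\<integral>\<^sup>+x. ennreal (f x) * indicator {0<..} x \<partial>lborel)"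
    by (intro nn_integral_cong) (auto simp: indicator_def)
  finally have "(\<integral>\<^sup>+x. ennreal (f x) * indicator {0<..} x \<partial>lborel) = ennreal (B - A)"
    by (simp add: eq)
  moreover have "0 \<le> (LINT x:{0<..}|lborel. f x)"
    unfolding set_lebesgue_integral_def by (rule Bochner_Integration.integral_nonneg)
      (use f in \<open>auto simp: indicator_def\<close>)
  ultimately show ?thesis by (simp add: eq)
qed

lemma nn_integral_inverse_affine_square:
  fixes a c :: real
  assumes "0 < a" "0 < c"
  shows "(\<integral>\<^sup>+x. ennreal (1 / (x * a + c)\<^sup>2) * indicator {0<..} x \<partial>lborel) = ennreal (1 / (a * c))"
proof -
  have pos: "0 < x * a + c" if "0 < x" for x
    using assms that by (simp add: add_pos_pos)
  have "(\<integral>\<^sup>+x. ennreal (1 / (x * a + c)\<^sup>2) * indicator {0<..} x \<partial>lborel) =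
      ennreal (0 - - (inverse c / a))"
  proof (rule nn_integral_FTC_greaterThan[THEN conjunct2])
    show "((\<lambda>x. - (inverse (x * a + c) / a)) has_real_derivative 1 / (x * a + c)\<^sup>2) (at x)"
      if "0 < x" for x
      using assms pos[OF that]
      by (auto intro!: derivative_eq_intros simp: power2_eq_square divide_inverse)
    show "isCont (\<lambda>x. 1 / (x * a + c)\<^sup>2) x" if "0 < x" for x
      using pos[OF that] by (auto intro!: continuous_intros)
    have "((\<lambda>x. - (inverse (x * a + c) / a)) \<longlongrightarrow> - (inverse (0 * a + c) / a)) (at_right 0)"
      using assms by (intro tendsto_intros) auto
    then show "((\<lambda>x. - (inverse (x * a + c) / a)) \<longlongrightarrow> - (inverse c / a)) (at_right 0)"
      by simp
    show "((\<lambda>x. - (inverse (x * a + c) / a)) \<longlongrightarrow> 0) at_top"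
      using assms by real_asymp
  qed auto
  then show ?thesis by (simp add: divide_inverse mult.commute)
qed

text \<open>Partial fractions: the primitive is the logarithm of the quotient of the two affine
  factors. The hypothesis \<open>less\<close> keeps these factors from being proportional.\<close>

lemma nn_integral_inverse_affine_product:
  fixes a b c d :: real
  assumes pos: "0 < a" "0 < b" "0 < c" "0 < d" and less: "b * c < a * d"
  shows "(\<integral>\<^sup>+x. ennreal (1 / ((a + b * x) * (c + d * x))) * indicator {0<..} x \<partial>lborel) =
      ennreal (ln (a * d / (b * c)) / (a * d - b * c))"
proof -
  let ?F = "\<lambda>x. (ln (c + d * x) - ln (a + b * x)) / (a * d - b * c)"
  have ps: "0 < a + b * x" "0 < c + d * x" if "0 < x" for x
    using pos that by (simp_all add: add_pos_pos)
  have "(\<integral>\<^sup>+x. ennreal (1 / ((a + b * x) * (c + d * x))) * indicator {0<..} x \<partial>lborel) =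
      ennreal ((ln d - ln b) / (a * d - b * c) - (ln c - ln a) / (a * d - b * c))"
  proof (rule nn_integral_FTC_greaterThan[THEN conjunct2])
    show "(?F has_real_derivative 1 / ((a + b * x) * (c + d * x))) (at x)" if "0 < x" for x
    proof -
      have "d / (c + d * x) - b / (a + b * x) = (a * d - b * c) / ((a + b * x) * (c + d * x))"
        using ps[OF that] by (simp add: field_simps)
      then have "(d / (c + d * x) - b / (a + b * x)) / (a * d - b * c) =
          1 / ((a + b * x) * (c + d * x))"
        using less by simp
      then show ?thesis
        using ps[OF that] by (auto intro!: derivative_eq_intros)
    qed
    show "isCont (\<lambda>x. 1 / ((a + b * x) * (c + d * x))) x" if "0 < x" for x
      using ps[OF that] by (auto intro!: continuous_intros)
    show "0 \<le> 1 / ((a + b * x) * (c + d * x))" if "0 < x" for x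
      using ps[OF that] by simp
    have "(?F \<longlongrightarrow> (ln (c + d * 0) - ln (a + b * 0)) / (a * d - b * c)) (at_right 0)"
      using pos less by (intro tendsto_intros) auto
    then show "(?F \<longlongrightarrow> (ln c - ln a) / (a * d - b * c)) (at_right 0)"
      by simp
    have "((\<lambda>x. ln (c + d * x) - ln (a + b * x)) \<longlongrightarrow> ln d - ln b) at_top"
      using pos by real_asymp
    then show "(?F \<longlongrightarrow> (ln d - ln b) / (a * d - b * c)) at_top"
      by (rule tendsto_divide[OF _ tendsto_const]) (use less in auto)
  qed
  also have "(ln d - ln b) / (a * d - b * c) - (ln c - ln a) / (a * d - b * c) =
      ln (a * d / (b * c)) / (a * d - b * c)"
    using pos by (simp add: ln_div ln_mult diff_divide_distrib add_divide_distrib)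
  finally show ?thesis .
qed

context
  fixes A B C :: real
  assumes angles: "0 < A" "0 < B" "0 < C" "A + B + C = pi"
begin

private lemma sin_pos: "0 < sin A" "0 < sin B" "0 < sin C"
  using angles by (auto intro!: sin_gt_zero)

lemma sin_triangle: "sin A = sin B * cos C + cos B * sin C" "sin C = sin A * cos B + cos A * sin B"
proof -
  have "A = pi - (B + C)" "C = pi - (A + B)" using angles by simp_all
  then show "sin A = sin B * cos C + cos B * sin C" "sin C = sin A * cos B + cos A * sin B"
    by (metis sin_add sin_pi_minus)+
qed

text \<open>This is the law of cosines for the triangle whose sides are the sines of its angles,
  that is, whose circumscribed circle has diameter one.\<close>

lemma sin_law_of_cosines: "(sin B)\<^sup>2 = (sin A)\<^sup>2 + (sin C)\<^sup>2 - 2 * sin A * sin C * cos B"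
proof -
  have "B = pi - (A + C)" using angles by simp
  then have "sin B = sin A * cos C + cos A * sin C" "cos B = sin A * sin C - cos A * cos C"
    by (metis sin_add sin_pi_minus) (metis \<open>B = pi - (A + C)\<close> cos_add cos_pi_minus minus_diff_eq)
  then show ?thesis
    using sin_cos_squared_add[of A] sin_cos_squared_add[of C] by algebra
qed

text \<open>By the law of cosines the middle coefficient is
  \<open>2 * sin A * sin C * cos B\<close>; then the square is completed. Positivity for every real
  \<open>a\<close> follows.\<close>

private lemma denominator_eq:
  "(sin C)\<^sup>2 * a\<^sup>2 + ((sin A)\<^sup>2 + (sin C)\<^sup>2 - (sin B)\<^sup>2) * a + (sin A)\<^sup>2 =
    (sin C * a + sin A * cos B)\<^sup>2 + (sin A * sin B)\<^sup>2"
  using sin_law_of_cosines sin_cos_squared_add[of B] by algebra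

lemma triangle_denominator_pos:
  "0 < (sin C)\<^sup>2 * a\<^sup>2 + ((sin A)\<^sup>2 + (sin C)\<^sup>2 - (sin B)\<^sup>2) * a + (sin A)\<^sup>2"
  unfolding denominator_eq using sin_pos by (simp add: add_nonneg_pos)

text \<open>Up to scale, \<open>\<phi> a\<close> is the angle between \<open>x\<close> and \<open>x + z a e\<^bsup>iB\<^esup>\<close>, where \<open>x = sin A\<close> and \<open>z = sin C\<close>;
  the denominator below is the squared modulus of that complex number.\<close>

lemma nn_integral_triangle:
  shows lobachevsky_sum_nonneg: "0 \<le> lobachevsky A + lobachevsky B + lobachevsky C"
    and "(\<integral>\<^sup>+a. ennreal (ln ((a + 1) * ((sin C)\<^sup>2 * a + (sin A)\<^sup>2) / ((sin B)\<^sup>2 * a)) /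
        ((sin C)\<^sup>2 * a\<^sup>2 + ((sin A)\<^sup>2 + (sin C)\<^sup>2 - (sin B)\<^sup>2) * a + (sin A)\<^sup>2)) *
      indicator {0<..} a \<partial>lborel) =
    ennreal (2 * (lobachevsky A + lobachevsky B + lobachevsky C) / (sin A * sin B * sin C))"
    (is "(\<integral>\<^sup>+a. ennreal (?f a) * _ \<partial>lborel) = _")
proof -
  \<comment> \<open>\<open>\<tau> a\<close> is the cotangent of \<open>\<phi> a\<close>. The form
    \<open>pi/2 - arctan\<close> also covers obtuse angles.\<close>
  define \<tau> where "\<tau> a = (cos B + sin A / (sin C * a)) / sin B" for a
  define \<phi> where "\<phi> a = pi/2 - arctan (\<tau> a)" for a
  \<comment> \<open>In the variable \<phi> the integrand is a signed sum of four logarithms of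
    sines, and \<open>G\<close> is its primitive.\<close>
  define G where "G \<phi> = lobachevsky \<phi> - lobachevsky (B - \<phi>) - lobachevsky (C + \<phi>) -
    lobachevsky (A + \<phi>)" for \<phi>
  let ?k = "sin A * sin B * sin C"
  let ?q = "\<lambda>a. (sin C)\<^sup>2 * a\<^sup>2 + ((sin A)\<^sup>2 + (sin C)\<^sup>2 - (sin B)\<^sup>2) * a + (sin A)\<^sup>2"
  have k: "?k > 0" using sin_pos by simp
  have arctan_cot: "arctan (cos B / sin B) = pi/2 - B"
  proof -
    have "tan (pi/2 - B) = cos B / sin B"
      by (simp add: tan_def sin_diff cos_diff)
    then show ?thesis
      using angles by (intro arctan_unique) auto
  qed
  have \<phi>: "0 < \<phi> a" "\<phi> a < B" if "0 < a" for a
  proof -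
    show "0 < \<phi> a" using arctan_ubound[of "\<tau> a"] by (simp add: \<phi>_def)
    have "cos B / sin B < \<tau> a"
      unfolding \<tau>_def using sin_pos that by (intro divide_strict_right_mono) auto
    then have "pi/2 - B < arctan (\<tau> a)"
      by (simp add: arctan_cot[symmetric] arctan_less_iff)
    then show "\<phi> a < B" by (simp add: \<phi>_def)
  qed
  have D\<phi>: "(\<phi> has_real_derivative ?k / ?q a) (at a)" if "0 < a" for a
  proof -
    have "(\<tau> has_real_derivative - (sin A / (sin C * a\<^sup>2)) / sin B) (at a)"
      unfolding \<tau>_def using sin_pos that
      by (auto intro!: derivative_eq_intros simp: power2_eq_square field_simps)
    then have "(\<phi> has_real_derivative - (- (sin A / (sin C * a\<^sup>2)) / sin B / (1 + (\<tau> a)\<^sup>2))) (at a)"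
      unfolding \<phi>_def
      by (auto intro!: derivative_eq_intros simp: divide_simps)
    moreover have "?q a = (1 + (\<tau> a)\<^sup>2) * (sin C * a * sin B)\<^sup>2"
    proof -
      have "\<tau> a * (sin C * a * sin B) = sin C * a * cos B + sin A"
        unfolding \<tau>_def using sin_pos that by (simp add: field_simps)
      then have "(1 + (\<tau> a)\<^sup>2) * (sin C * a * sin B)\<^sup>2 = (sin C * a * sin B)\<^sup>2 + (sin C * a * cos B + sin A)\<^sup>2"
        by algebra
      then show ?thesis
        unfolding denominator_eq using sin_cos_squared_add[of B] by algebra
    qed
    moreover have "1 + (\<tau> a)\<^sup>2 > 0" by (simp add: add_pos_nonneg)
    ultimately show ?thesis
      using sin_pos that by (simp add: power2_eq_square mult_ac)
  qed
  have DG: "(G has_real_derivative ln (2 * sin (C + \<phi>)) + ln (2 * sin (A + \<phi>)) -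
      ln (2 * sin (B - \<phi>)) - ln (2 * sin \<phi>)) (at \<phi>)" if "0 < \<phi>" "\<phi> < B" for \<phi>
    unfolding G_def using that angles by (auto intro!: derivative_eq_intros)
  \<comment> \<open>Each of the other three sines is \<open>sin (\<phi> a)\<close> times a rational
    expression in \<open>a\<close>, so \<open>sin (\<phi> a)\<close> cancels from the
    quotient.\<close>
  have log_eq: "ln (2 * sin (C + \<phi> a)) + ln (2 * sin (A + \<phi> a)) -
      ln (2 * sin (B - \<phi> a)) - ln (2 * sin (\<phi> a)) =
      ln ((a + 1) * ((sin C)\<^sup>2 * a + (sin A)\<^sup>2) / ((sin B)\<^sup>2 * a))" if a: "0 < a" for a
  proof -
    have s: "0 < sin (\<phi> a)" "0 < sin (B - \<phi> a)" "0 < sin (A + \<phi> a)" "0 < sin (C + \<phi> a)"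
      using \<phi>[OF a] angles by (auto intro!: sin_gt_zero)
    have c: "cos (\<phi> a) = \<tau> a * sin (\<phi> a)"
    proof -
      have "cos (\<phi> a) = sin (arctan (\<tau> a))" "sin (\<phi> a) = cos (arctan (\<tau> a))"
        by (simp_all add: \<phi>_def cos_diff sin_diff)
      moreover have "sin (arctan (\<tau> a)) = \<tau> a * cos (arctan (\<tau> a))"
        using tan_arctan[of "\<tau> a"] cos_arctan_not_zero[of "\<tau> a"] by (simp add: tan_def field_simps)
      ultimately show ?thesis by simp
    qed
    have 1: "sin (B - \<phi> a) = sin (\<phi> a) * (sin A / (sin C * a))"
      using sin_pos a unfolding sin_diff c \<tau>_def by (simp add: field_simps)
    have 2: "sin (C + \<phi> a) = sin (\<phi> a) * (sin A * (a + 1) / (sin B * a))"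
      using sin_pos a unfolding sin_add c \<tau>_def
      by (simp add: field_simps) (use sin_triangle in algebra)
    have 3: "sin (A + \<phi> a) = sin (\<phi> a) * (((sin C)\<^sup>2 * a + (sin A)\<^sup>2) / (sin B * sin C * a))"
      using sin_pos a unfolding sin_add c \<tau>_def
      by (simp add: field_simps) (use sin_triangle in algebra)
    have "ln (2 * sin (C + \<phi> a)) + ln (2 * sin (A + \<phi> a)) - ln (2 * sin (B - \<phi> a)) - ln (2 * sin (\<phi> a)) =
        ln (sin (C + \<phi> a) * sin (A + \<phi> a) / (sin (B - \<phi> a) * sin (\<phi> a)))"
      using s by (simp add: ln_mult ln_div)
    also have "sin (C + \<phi> a) * sin (A + \<phi> a) / (sin (B - \<phi> a) * sin (\<phi> a)) =
        (a + 1) * ((sin C)\<^sup>2 * a + (sin A)\<^sup>2) / ((sin B)\<^sup>2 * a)"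
      unfolding 1 2 3 using sin_pos a s(1) by (simp add: divide_simps power2_eq_square)
    finally show ?thesis .
  qed
  have contG: "continuous_on {0..B} G"
    unfolding G_def using angles by (intro continuous_intros) auto
  have G0: "G 0 = - (lobachevsky A + lobachevsky B + lobachevsky C)"
    by (simp add: G_def)
  \<comment> \<open>At the far end the arguments \<open>C + B\<close> and \<open>A + B\<close> are
    supplements of \<open>A\<close> and \<open>C\<close>, so reflection reverses their signs and
    \<open>G B = - G 0\<close>.\<close>
  have sum: "C + B = pi - A" "A + B = pi - C" and "A \<le> pi" "C \<le> pi"
    using angles by simp_all
  have GB: "G B = lobachevsky A + lobachevsky B + lobachevsky C"
    using lobachevsky_pi_minus[of A] lobachevsky_pi_minus[of C] \<open>A \<le> pi\<close> \<open>C \<le> pi\<close> angles(1-3)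
    unfolding G_def sum by simp
  have limG: "((\<lambda>a. G (\<phi> a)) \<longlongrightarrow> G y) F" if "(\<phi> \<longlongrightarrow> y) F" "y \<in> {0..B}" "\<forall>\<^sub>F a in F. 0 < a" for F y
    by (rule continuous_on_tendsto_compose[OF contG that(1,2)])
      (use that(3) in \<open>eventually_elim, use \<phi> in \<open>auto intro: less_imp_le\<close>\<close>)
  have FTC: "G 0 / ?k \<le> G B / ?k \<and>
      (\<integral>\<^sup>+a. ennreal (?f a) * indicator {0<..} a \<partial>lborel) = ennreal (G B / ?k - G 0 / ?k)"
  proof (rule nn_integral_FTC_greaterThan)
    show "((\<lambda>a. G (\<phi> a) / ?k) has_real_derivative ?f a) (at a)" if "0 < a" for a
    proof -
      have "((\<lambda>a. G (\<phi> a)) has_real_derivative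
          ln ((a + 1) * ((sin C)\<^sup>2 * a + (sin A)\<^sup>2) / ((sin B)\<^sup>2 * a)) * (?k / ?q a)) (at a)"
        using DERIV_chain2[OF DG[OF \<phi>[OF that]] D\<phi>[OF that]] by (simp only: log_eq[OF that])
      from DERIV_cdivide[OF this, of ?k] show ?thesis using sin_pos by simp
    qed
    have num: "0 < (a + 1) * ((sin C)\<^sup>2 * a + (sin A)\<^sup>2)" if "0 < a" for a
      using sin_pos that by (intro mult_pos_pos add_nonneg_pos) auto
    show "isCont ?f a" if "0 < a" for a
      using triangle_denominator_pos[of a] num[OF that] that sin_pos
      by (intro continuous_intros) auto
    show "0 \<le> ?f a" if "0 < a" for a
    proof (rule divide_nonneg_pos)
      \<comment> \<open>Numerator minus denominator of the argument is exactly the positive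
        quadratic \<open>?q a\<close>, so the argument is at least 1.\<close>
      show "0 \<le> ln ((a + 1) * ((sin C)\<^sup>2 * a + (sin A)\<^sup>2) / ((sin B)\<^sup>2 * a))"
        using triangle_denominator_pos[of a] that sin_pos
        by (intro ln_ge_zero) (simp add: field_simps power2_eq_square)
    qed (rule triangle_denominator_pos)
    show "((\<lambda>a. G (\<phi> a) / ?k) \<longlongrightarrow> G 0 / ?k) (at_right 0)"
    proof (intro tendsto_divide tendsto_const limG)
      have "((\<lambda>a. pi/2 - arctan ((cos B + sin A / (sin C * a)) / sin B)) \<longlongrightarrow> 0) (at_right 0)"
        using sin_pos by real_asymp
      then show "(\<phi> \<longlongrightarrow> 0) (at_right 0)"
        by (simp add: \<phi>_def[abs_def] \<tau>_def)
      show "\<forall>\<^sub>F a in at_right 0. (0::real) < a"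
        by (auto simp: eventually_at_filter)
    qed (use angles k in auto)
    show "((\<lambda>a. G (\<phi> a) / ?k) \<longlongrightarrow> G B / ?k) at_top"
    proof (intro tendsto_divide tendsto_const limG)
      have "((\<lambda>a. pi/2 - arctan ((cos B + sin A / (sin C * a)) / sin B)) \<longlongrightarrow>
          pi/2 - arctan ((cos B + 0) / sin B)) at_top"
      proof (intro tendsto_intros)
        show "((\<lambda>a. sin A / (sin C * a)) \<longlongrightarrow> 0) at_top"
          using sin_pos by real_asymp
      qed (use sin_pos in auto)
      then show "(\<phi> \<longlongrightarrow> B) at_top"
        by (simp add: \<phi>_def[abs_def] \<tau>_def arctan_cot)
    qed (use angles k in \<open>auto intro: eventually_gt_at_top\<close>)
  qed
  show "0 \<le> lobachevsky A + lobachevsky B + lobachevsky C"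
    using FTC[THEN conjunct1] k by (simp add: divide_le_cancel G0 GB)
  have "G B / ?k - G 0 / ?k = 2 * (lobachevsky A + lobachevsky B + lobachevsky C) / ?k"
    by (simp add: G0 GB diff_divide_distrib add_divide_distrib)
  with FTC show "(\<integral>\<^sup>+a. ennreal (?f a) * indicator {0<..} a \<partial>lborel) =
      ennreal (2 * (lobachevsky A + lobachevsky B + lobachevsky C) / ?k)"
    by simp
qed

end

section \<open>Integration over the octant\<close>

lemma Basis_vec3: "(Basis :: (real^3) set) = {axis 2 1, axis 3 1, axis 1 1}"
  by (auto simp: Basis_vec_def UNIV_3)

text \<open>Lebesgue measure is a product over the basis. The coordinates are split off in the order
  2, 3, 1, because the octant integral is easiest with the first variable innermost and the second
  outermost.\<close>

lemma nn_integral_lborel_vec3: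
  fixes F :: "real^3 \<Rightarrow> ennreal"
  assumes [measurable]: "F \<in> borel_measurable borel"
  shows "(\<integral>\<^sup>+x. F x \<partial>lborel) =
    (\<integral>\<^sup>+b. \<integral>\<^sup>+c. \<integral>\<^sup>+a. F (vector [a, b, c]) \<partial>lborel \<partial>lborel \<partial>lborel)"
proof -
  define e1 e2 e3 :: "real^3" where "e1 = axis 1 1" and "e2 = axis 2 1" and "e3 = axis 3 1"
  have B: "(Basis :: (real^3) set) = {e2, e3, e1}"
    by (simp add: Basis_vec3 e1_def e2_def e3_def)
  have d: "e1 \<noteq> e2" "e1 \<noteq> e3" "e2 \<noteq> e3" "e2 \<noteq> e1" "e3 \<noteq> e1" "e3 \<noteq> e2"
    by (simp_all add: e1_def e2_def e3_def axis_eq_axis)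
  have v: "b *\<^sub>R e2 + (c *\<^sub>R e3 + a *\<^sub>R e1) = vector [a, b, c]" for a b c
    by (simp add: vec_eq_iff forall_3 axis_def e1_def e2_def e3_def)
  have meas: "(\<lambda>x. F (g x *\<^sub>R e2 + (h x *\<^sub>R e3 + f x *\<^sub>R e1))) \<in> borel_measurable M"
    if "f \<in> borel_measurable M" "g \<in> borel_measurable M" "h \<in> borel_measurable M"
    for f g h and M :: "(real^3 \<Rightarrow> real) measure"
    using that by (intro measurable_compose[OF _ assms] borel_measurable_add borel_measurable_scaleR) auto
  have comp: "(\<lambda>x. x i :: real) \<in> borel_measurable (Pi\<^sub>M I (\<lambda>_. lborel))" if "i \<in> I"
    for i and I :: "(real^3) set"
    using measurable_component_singleton[OF that, of "\<lambda>_. lborel :: real measure"] by simp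
  interpret product_sigma_finite "\<lambda>_::real^3. lborel :: real measure"
    by standard
  have "(\<integral>\<^sup>+x. F x \<partial>lborel) =
      (\<integral>\<^sup>+x. F (x e2 *\<^sub>R e2 + (x e3 *\<^sub>R e3 + x e1 *\<^sub>R e1)) \<partial>Pi\<^sub>M {e2, e3, e1} (\<lambda>_. lborel))"
  proof -
    have sum: "(\<Sum>b\<in>{e2, e3, e1}. f b *\<^sub>R b) = f e2 *\<^sub>R e2 + (f e3 *\<^sub>R e3 + f e1 *\<^sub>R e1)" for f
      using d by simp
    have "(\<lambda>f. \<Sum>b\<in>{e2, e3, e1}. f b *\<^sub>R b) \<in> Pi\<^sub>M {e2, e3, e1} (\<lambda>_. lborel) \<rightarrow>\<^sub>M borel"
      unfolding sum by (intro borel_measurable_add borel_measurable_scaleR comp borel_measurable_const) auto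
    then show ?thesis
      by (subst lborel_eq, unfold B, subst nn_integral_distr) (simp_all add: assms sum)
  qed
  also have "\<dots> = (\<integral>\<^sup>+b. \<integral>\<^sup>+x. F (b *\<^sub>R e2 + (x e3 *\<^sub>R e3 + x e1 *\<^sub>R e1))
      \<partial>Pi\<^sub>M {e3, e1} (\<lambda>_. lborel) \<partial>lborel)"
  proof -
    have "(\<lambda>x. F (x e2 *\<^sub>R e2 + (x e3 *\<^sub>R e3 + x e1 *\<^sub>R e1))) \<in>
        borel_measurable (Pi\<^sub>M {e2, e3, e1} (\<lambda>_. lborel))"
      by (rule meas; rule comp; simp)
    then show ?thesis
      using d by (subst product_nn_integral_insert_rev) simp_all
  qed
  also have "\<dots> = (\<integral>\<^sup>+b. \<integral>\<^sup>+c. \<integral>\<^sup>+x. F (b *\<^sub>R e2 + (c *\<^sub>R e3 + x e1 *\<^sub>R e1))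
      \<partial>Pi\<^sub>M {e1} (\<lambda>_. lborel) \<partial>lborel \<partial>lborel)"
  proof (rule nn_integral_cong)
    fix b :: real
    have "(\<lambda>x. F (b *\<^sub>R e2 + (x e3 *\<^sub>R e3 + x e1 *\<^sub>R e1))) \<in>
        borel_measurable (Pi\<^sub>M {e3, e1} (\<lambda>_. lborel))"
      by (rule meas, rule comp, simp, rule measurable_const, simp, rule comp, simp)
    then show "(\<integral>\<^sup>+x. F (b *\<^sub>R e2 + (x e3 *\<^sub>R e3 + x e1 *\<^sub>R e1)) \<partial>Pi\<^sub>M {e3, e1} (\<lambda>_. lborel)) =
        (\<integral>\<^sup>+c. \<integral>\<^sup>+x. F (b *\<^sub>R e2 + (c *\<^sub>R e3 + x e1 *\<^sub>R e1)) \<partial>Pi\<^sub>M {e1} (\<lambda>_. lborel) \<partial>lborel)"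
      using d by (subst product_nn_integral_insert_rev) simp_all
  qed
  also have "\<dots> = (\<integral>\<^sup>+b. \<integral>\<^sup>+c. \<integral>\<^sup>+a. F (b *\<^sub>R e2 + (c *\<^sub>R e3 + a *\<^sub>R e1))
      \<partial>lborel \<partial>lborel \<partial>lborel)"
  proof (intro nn_integral_cong)
    fix b c :: real
    have "(\<lambda>a. F (b *\<^sub>R e2 + (c *\<^sub>R e3 + a *\<^sub>R e1))) \<in> borel_measurable lborel"
      by (intro measurable_compose[OF _ assms] borel_measurable_add borel_measurable_scaleR) auto
    then show "(\<integral>\<^sup>+x. F (b *\<^sub>R e2 + (c *\<^sub>R e3 + x e1 *\<^sub>R e1)) \<partial>Pi\<^sub>M {e1} (\<lambda>_. lborel)) =
        (\<integral>\<^sup>+a. F (b *\<^sub>R e2 + (c *\<^sub>R e3 + a *\<^sub>R e1)) \<partial>lborel)"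
      by (rule product_nn_integral_singleton)
  qed
  finally show ?thesis
    by (simp add: v)
qed

text \<open>A linear substitution in \<open>b\<close> reduces arbitrary coefficients to the
  normalised integral, where only the three products of opposite coefficients survive.\<close>

lemma nn_integral_triangle_scaled:
  fixes A B C m h12 h13 h14 h23 h24 h34 :: real
  assumes angles: "0 < A" "0 < B" "0 < C" "A + B + C = pi"
    and m: "0 < m"
    and pos: "0 < h12" "0 < h13" "0 < h14" "0 < h23" "0 < h24" "0 < h34"
    and p: "h12 * h34 = m * (sin A)\<^sup>2" and q: "h13 * h24 = m * (sin B)\<^sup>2"
    and r: "h14 * h23 = m * (sin C)\<^sup>2"
  shows "\<And>b. 0 < b \<Longrightarrow> h13 * (h24 * b) < (h12 * b + h14) * (h23 * b + h34)"
    and "(\<integral>\<^sup>+b. ennreal (ln ((h12 * b + h14) * (h23 * b + h34) / (h13 * (h24 * b))) /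
          ((h12 * b + h14) * (h23 * b + h34) - h13 * (h24 * b))) * indicator {0<..} b \<partial>lborel) =
        ennreal (2 * (lobachevsky A + lobachevsky B + lobachevsky C) / (m * sin A * sin B * sin C))"
proof -
  let ?N = "\<lambda>b. (h12 * b + h14) * (h23 * b + h34)"
  let ?n = "\<lambda>a. (a + 1) * ((sin C)\<^sup>2 * a + (sin A)\<^sup>2)"
  let ?q = "\<lambda>a. (sin C)\<^sup>2 * a\<^sup>2 + ((sin A)\<^sup>2 + (sin C)\<^sup>2 - (sin B)\<^sup>2) * a + (sin A)\<^sup>2"
  \<comment> \<open>With this scale \<open>h12 * (k * a) + h14\<close> becomes
    \<open>h14 * (a + 1)\<close>, the first factor of the normalised integrand.\<close>
  define k where "k = h14 / h12"
  have k: "0 < k" using pos by (simp add: k_def)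
  have km: "0 \<le> 1 / (k * m)" using k m by simp
  have s: "0 < sin A" "0 < sin B" "0 < sin C"
    using angles by (auto intro!: sin_gt_zero)
  have h14: "h14 = k * h12" using pos by (simp add: k_def)
  have N: "?N (k * a) = k * m * ?n a" for a
  proof -
    have "?N (k * a) = k * (a + 1) * ((h14 * h23) * a + h12 * h34)"
      unfolding h14 by (simp add: algebra_simps)
    then show ?thesis unfolding p r by (simp add: algebra_simps)
  qed
  have M: "h13 * (h24 * (k * a)) = k * m * ((sin B)\<^sup>2 * a)" for a
    using q by (simp add: mult_ac)
  have D: "?N (k * a) - h13 * (h24 * (k * a)) = k * m * ?q a" for a
    unfolding N M by algebra
  show "h13 * (h24 * b) < ?N b" if "0 < b" for b
  proof -
    have "0 < k * m * ?q (b / k)"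
      by (intro mult_pos_pos triangle_denominator_pos[OF angles] k m)
    with D[of "b / k"] k show ?thesis by simp
  qed
  let ?f = "\<lambda>b. ennreal (ln (?N b / (h13 * (h24 * b))) / (?N b - h13 * (h24 * b))) * indicator {0<..} b"
  have "(\<integral>\<^sup>+b. ?f b \<partial>lborel) = ennreal k * (\<integral>\<^sup>+a. ?f (k * a) \<partial>lborel)"
    using nn_integral_real_affine[of ?f k 0] k by simp
  also have "(\<integral>\<^sup>+a. ?f (k * a) \<partial>lborel) =
      (\<integral>\<^sup>+a. ennreal (1 / (k * m)) *
        (ennreal (ln (?n a / ((sin B)\<^sup>2 * a)) / ?q a) * indicator {0<..} a) \<partial>lborel)"
  proof (intro nn_integral_cong)
    fix a :: real
    have "ln (?N (k * a) / (h13 * (h24 * (k * a)))) / (?N (k * a) - h13 * (h24 * (k * a))) =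
        1 / (k * m) * (ln (?n a / ((sin B)\<^sup>2 * a)) / ?q a)"
      unfolding D unfolding N M using k m by (simp add: mult.assoc)
    then have "ennreal (ln (?N (k * a) / (h13 * (h24 * (k * a)))) / (?N (k * a) - h13 * (h24 * (k * a)))) =
        ennreal (1 / (k * m)) * ennreal (ln (?n a / ((sin B)\<^sup>2 * a)) / ?q a)"
      by (simp only: ennreal_mult'[OF km])
    moreover have "indicator {0<..} (k * a) = (indicator {0<..} a :: ennreal)"
      using k by (simp add: indicator_def zero_less_mult_iff)
    ultimately show "?f (k * a) = ennreal (1 / (k * m)) *
        (ennreal (ln (?n a / ((sin B)\<^sup>2 * a)) / ?q a) * indicator {0<..} a)"
      by (simp only: mult.assoc)
  qed
  also have "\<dots> = ennreal (1 / (k * m)) *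
      ennreal (2 * (lobachevsky A + lobachevsky B + lobachevsky C) / (sin A * sin B * sin C))"
    by (subst nn_integral_cmult) (simp_all add: nn_integral_triangle(2)[OF angles])
  also have "ennreal k * \<dots> =
      ennreal (k * (1 / (k * m) *
        (2 * (lobachevsky A + lobachevsky B + lobachevsky C) / (sin A * sin B * sin C))))"
    by (simp only: ennreal_mult'[OF km] ennreal_mult'[OF less_imp_le[OF k]])
  also have "k * (1 / (k * m) *
        (2 * (lobachevsky A + lobachevsky B + lobachevsky C) / (sin A * sin B * sin C))) =
      2 * (lobachevsky A + lobachevsky B + lobachevsky C) / (m * sin A * sin B * sin C)"
    using k m s by (simp add: field_simps)
  finally show "(\<integral>\<^sup>+b. ?f b \<partial>lborel) =
    ennreal (2 * (lobachevsky A + lobachevsky B + lobachevsky C) / (m * sin A * sin B * sin C))" .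
qed

text \<open>The quadratic form is affine in the first variable. Integrating that variable leaves the
  reciprocal of a product of two affine functions of the third, and integrating the third leaves the
  logarithmic integrand in the second.\<close>

lemma nn_integral_octant:
  fixes A B C m h12 h13 h14 h23 h24 h34 :: real
  assumes angles: "0 < A" "0 < B" "0 < C" "A + B + C = pi"
    and m: "0 < m"
    and pos: "0 < h12" "0 < h13" "0 < h14" "0 < h23" "0 < h24" "0 < h34"
    and pqr: "h12 * h34 = m * (sin A)\<^sup>2" "h13 * h24 = m * (sin B)\<^sup>2" "h14 * h23 = m * (sin C)\<^sup>2"
  shows "(\<integral>\<^sup>+l. ennreal (1 / (h12 * l$1 * l$2 + h13 * l$1 * l$3 + h14 * l$1 +
          h23 * l$2 * l$3 + h24 * l$2 + h34 * l$3)\<^sup>2) * indicator {l. \<forall>i. 0 < l$i} l \<partial>(lborel :: (real^3) measure)) =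
    ennreal (2 * (lobachevsky A + lobachevsky B + lobachevsky C) / (m * sin A * sin B * sin C))"
  (is "(\<integral>\<^sup>+l. ?f l \<partial>_) = _")
proof -
  have T: "{l::real^3. \<forall>i. 0 < l$i} \<in> sets borel"
    unfolding forall_3
    by (intro borel_open open_Collect_conj open_Collect_less continuous_intros)
  have Q: "(\<lambda>l::real^3. h12 * l$1 * l$2 + h13 * l$1 * l$3 + h14 * l$1 +
      h23 * l$2 * l$3 + h24 * l$2 + h34 * l$3) \<in> borel_measurable borel"
    by (intro borel_measurable_continuous_onI continuous_intros)
  have "(\<integral>\<^sup>+l. ?f l \<partial>lborel) = (\<integral>\<^sup>+b. \<integral>\<^sup>+c. \<integral>\<^sup>+a. ?f (vector [a, b, c]) \<partial>lborel \<partial>lborel \<partial>lborel)"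
  proof (rule nn_integral_lborel_vec3, rule borel_measurable_times_ennreal)
    show "(\<lambda>l::real^3. ennreal (1 / (h12 * l$1 * l$2 + h13 * l$1 * l$3 + h14 * l$1 +
        h23 * l$2 * l$3 + h24 * l$2 + h34 * l$3)\<^sup>2)) \<in> borel_measurable borel"
      by (rule measurable_compose[OF _ measurable_ennreal],
          intro borel_measurable_divide borel_measurable_power borel_measurable_const Q)
  qed (rule borel_measurable_indicator[OF T])
  also have "\<dots> = (\<integral>\<^sup>+b. ennreal (ln ((h12 * b + h14) * (h23 * b + h34) / (h13 * (h24 * b))) /
          ((h12 * b + h14) * (h23 * b + h34) - h13 * (h24 * b))) * indicator {0<..} b \<partial>lborel)"
  proof (rule nn_integral_cong)
    fix b :: real
    let ?I = "\<lambda>c. \<integral>\<^sup>+a. ?f (vector [a, b, c]) \<partial>lborel"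
    show "(\<integral>\<^sup>+c. ?I c \<partial>lborel) = ennreal (ln ((h12 * b + h14) * (h23 * b + h34) / (h13 * (h24 * b))) /
          ((h12 * b + h14) * (h23 * b + h34) - h13 * (h24 * b))) * indicator {0<..} b"
    proof (cases "0 < b")
      case b: True
      have "?I c = ennreal (1 / (((h12 * b + h14) + h13 * c) * (h24 * b + (h23 * b + h34) * c))) *
          indicator {0<..} c" for c
      proof (cases "0 < c")
        case c: True
        let ?a = "(h12 * b + h14) + h13 * c" and ?c = "h24 * b + (h23 * b + h34) * c"
        have "?f (vector [a, b, c]) = ennreal (1 / (a * ?a + ?c)\<^sup>2) * indicator {0<..} a" for a
        proof -
          have e: "h12 * a * b + h13 * a * c + h14 * a + h23 * b * c + h24 * b + h34 * c = a * ?a + ?c"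
            by (simp add: algebra_simps)
          show ?thesis
            unfolding vector_3 e using b c by (simp add: indicator_def forall_3)
        qed
        then have "?I c = (\<integral>\<^sup>+a. ennreal (1 / (a * ?a + ?c)\<^sup>2) * indicator {0<..} a \<partial>lborel)"
          by (simp only:)
        also have "\<dots> = ennreal (1 / (?a * ?c))"
          by (rule nn_integral_inverse_affine_square)
            (intro add_pos_pos mult_pos_pos pos b c)+
        finally show ?thesis using c by simp
      next
        case False
        then show ?thesis by (simp add: forall_3)
      qed
      then have "(\<integral>\<^sup>+c. ?I c \<partial>lborel) = (\<integral>\<^sup>+c. ennreal (1 / (((h12 * b + h14) + h13 * c) *
          (h24 * b + (h23 * b + h34) * c))) * indicator {0<..} c \<partial>lborel)"
        by (simp only:)
      also have "\<dots> = ennreal (ln ((h12 * b + h14) * (h23 * b + h34) / (h13 * (h24 * b))) /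
          ((h12 * b + h14) * (h23 * b + h34) - h13 * (h24 * b)))"
        by (rule nn_integral_inverse_affine_product)
          (intro add_pos_pos mult_pos_pos pos b nn_integral_triangle_scaled(1)[OF assms b])+
      finally show ?thesis using b by simp
    next
      case False
      then show ?thesis by (simp add: forall_3)
    qed
  qed
  also have "\<dots> = ennreal (2 * (lobachevsky A + lobachevsky B + lobachevsky C) / (m * sin A * sin B * sin C))"
    by (rule nn_integral_triangle_scaled(2)[OF assms])
  finally show ?thesis .
qed

section \<open>Projective parametrisation of a tetrahedron\<close>

text \<open>For nonnegative integrands integrability and absolute integrability coincide, so the
  change of variables for absolutely integrable maps into \<open>real^1\<close> carries
  over.\<close>

lemma has_integral_change_of_variables_nonneg:
  fixes f :: "real^'n::{finite,wellorder} \<Rightarrow> real" and g :: "real^'n::_ \<Rightarrow> real^'n::_"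
  assumes "X \<in> sets lebesgue"
    and "\<And>x. x \<in> X \<Longrightarrow> (g has_derivative g' x) (at x within X)"
    and "inj_on g X" and nonneg: "\<And>y. y \<in> g ` X \<Longrightarrow> 0 \<le> f y"
  shows "((\<lambda>x. \<bar>det (matrix (g' x))\<bar> * f (g x)) has_integral b) X \<longleftrightarrow> (f has_integral b) (g ` X)"
proof -
  have "(\<lambda>x. \<bar>det (matrix (g' x))\<bar> * f (g x)) absolutely_integrable_on X \<longleftrightarrow>
      (\<lambda>x. \<bar>det (matrix (g' x))\<bar> * f (g x)) integrable_on X"
    by (rule absolutely_integrable_on_iff_nonneg) (simp add: nonneg)
  moreover have "f absolutely_integrable_on (g ` X) \<longleftrightarrow> f integrable_on (g ` X)"
    by (rule absolutely_integrable_on_iff_nonneg) (rule nonneg)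
  ultimately show ?thesis
    using has_absolute_integral_change_of_variables[OF assms(1-3), of "\<lambda>x. vec (f x) :: real^1" "vec b"]
    unfolding absolutely_integrable_on_1_iff integral_on_1_eq
    by (simp add: has_integral_iff vec_eq_iff)
qed

lemma affine_image_std_simplex:
  fixes M :: "real^3^3" and c :: "real^3"
  shows "(\<lambda>v. c + M *v v) ` (convex hull (insert 0 Basis)) =
    convex hull {c, c + column 1 M, c + column 2 M, c + column 3 M}"
proof -
  have "(\<lambda>v. c + M *v v) ` (convex hull (insert 0 Basis)) =
      (+) c ` ((*v) M ` (convex hull (insert 0 Basis)))"
    by (simp add: image_image)
  also have "(*v) M ` (convex hull (insert 0 Basis)) = convex hull ((*v) M ` insert 0 Basis)"
    by (rule convex_hull_linear_image[OF matrix_vector_mul_linear])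
  also have "(+) c ` \<dots> = convex hull ((+) c ` (*v) M ` insert 0 Basis)"
    by (rule convex_hull_translation[symmetric])
  also have "(+) c ` (*v) M ` insert 0 Basis = {c, c + column 1 M, c + column 2 M, c + column 3 M}"
    by (auto simp: Basis_vec3 matrix_vector_mult_basis)
  finally show ?thesis .
qed

text \<open>The hull is a translate of the image of the standard simplex under a singular linear
  map. This settles flat tetrahedra.\<close>

lemma negligible_convex_hull_singular:
  fixes M :: "real^3^3" and c :: "real^3"
  assumes "det M = 0"
  shows "negligible (convex hull {c, c + column 1 M, c + column 2 M, c + column 3 M})"
proof -
  have "\<not> inj ((*v) M)"
    using det_nz_iff_inj[of "(*v) M"] assms by simp
  then have "negligible ((*v) M ` (convex hull (insert 0 Basis)))"
    by (intro negligible_linear_singular_image) simp_all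
  from negligible_translation[OF this, of c] show ?thesis
    by (simp add: affine_image_std_simplex[symmetric] image_image)
qed

lemma sum_Basis_vec3: "sum (\<lambda>i. x \<bullet> i) Basis = x$1 + x$2 + x$3" for x :: "real^3"
  by (simp add: Basis_vec3 axis_eq_axis inner_axis)

text \<open>The point with homogeneous coordinates \<open>(l, 1)\<close> in barycentric form: the
  vertex at the origin receives the remaining weight
  \<open>1 / (1 + (l$1 + l$2 + l$3))\<close>.\<close>

definition simplex_chart :: "real^3 \<Rightarrow> real^3" where
  "simplex_chart l = (1 / (1 + (l$1 + l$2 + l$3))) *\<^sub>R l"

definition simplex_chart_deriv :: "real^3 \<Rightarrow> real^3 \<Rightarrow> real^3" where
  "simplex_chart_deriv l h = (1 / (1 + (l$1 + l$2 + l$3))) *\<^sub>R h -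
     ((h$1 + h$2 + h$3) / (1 + (l$1 + l$2 + l$3))\<^sup>2) *\<^sub>R l"

lemma octant_image_simplex_chart:
  "simplex_chart ` {l. \<forall>i. 0 < l$i} = interior (convex hull (insert 0 Basis))"
proof -
  have "interior (convex hull (insert 0 Basis)) = {v::real^3. (\<forall>i. 0 < v$i) \<and> v$1 + v$2 + v$3 < 1}"
    unfolding interior_std_simplex sum_Basis_vec3
    by (auto simp: Basis_vec3 forall_3 inner_axis)
  moreover have "v \<in> simplex_chart ` {l. \<forall>i. 0 < l$i}"
    if v: "\<forall>i. 0 < v$i" "v$1 + v$2 + v$3 < 1" for v :: "real^3"
  proof
    \<comment> \<open>The weight of the vertex at the origin; dividing by it inverts the
      chart.\<close>
    let ?t = "1 - (v$1 + v$2 + v$3)"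
    have t: "0 < ?t" using v(2) by simp
    have "1 + (v$1 / ?t + v$2 / ?t + v$3 / ?t) = (?t + (v$1 + v$2 + v$3)) / ?t"
      using t by (simp only: add_divide_distrib) simp
    then have "1 + (v$1 / ?t + v$2 / ?t + v$3 / ?t) = 1 / ?t" by simp
    then show "v = simplex_chart ((1 / ?t) *\<^sub>R v)"
      using t by (simp add: simplex_chart_def)
    show "(1 / ?t) *\<^sub>R v \<in> {l. \<forall>i. 0 < l$i}"
      using v by simp
  qed
  moreover have "simplex_chart l \<in> {v. (\<forall>i. 0 < v$i) \<and> v$1 + v$2 + v$3 < 1}" if l: "\<forall>i. 0 < l$i" for l
  proof -
    have "0 < l$1 + l$2 + l$3" using l by (simp add: add_pos_pos)
    then show ?thesis using l by (simp add: simplex_chart_def add_divide_distrib[symmetric])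
  qed
  ultimately show ?thesis by auto
qed

lemma inj_on_simplex_chart: "inj_on simplex_chart {l. \<forall>i. 0 < l$i}"
proof (rule inj_onI)
  fix l l' :: "real^3"
  assume l: "l \<in> {l. \<forall>i. 0 < l$i}" "l' \<in> {l. \<forall>i. 0 < l$i}" and eq: "simplex_chart l = simplex_chart l'"
  define s s' where "s = l$1 + l$2 + l$3" and "s' = l'$1 + l'$2 + l'$3"
  have pos: "0 < s" "0 < s'" using l by (simp_all add: s_def s'_def add_pos_pos)
  have *: "l$i / (1 + s) = l'$i / (1 + s')" for i
    using arg_cong[OF eq, of "\<lambda>v. v$i"] by (simp add: simplex_chart_def s_def s'_def)
  have "s / (1 + s) = s' / (1 + s')"
    using *[of 1] *[of 2] *[of 3] by (simp add: s_def s'_def add_divide_distrib)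
  then have "s = s'" using pos by (simp add: field_simps)
  then show "l = l'" using * pos by (simp add: vec_eq_iff)
qed

lemma has_derivative_simplex_chart:
  assumes "\<forall>i. 0 < l$i"
  shows "(simplex_chart has_derivative simplex_chart_deriv l) (at l)"
proof -
  have "0 < l$1 + l$2 + l$3" using assms by (simp add: add_pos_pos)
  then have "1 + (l$1 + l$2 + l$3) \<noteq> 0" by linarith
  then show ?thesis
    unfolding simplex_chart_def[abs_def] simplex_chart_deriv_def[abs_def]
    by (auto intro!: derivative_eq_intros bounded_linear_imp_has_derivative bounded_linear_vec_nth
        simp: power2_eq_square divide_inverse)
qed

lemma linear_simplex_chart_deriv: "linear (simplex_chart_deriv l)"
  unfolding simplex_chart_deriv_def[abs_def]
  by (rule linearI) (simp_all add: algebra_simps add_divide_distrib)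

text \<open>With \<open>s = 1 + (l$1 + l$2 + l$3)\<close> and \<open>q = 1 / s\<close>, the
  derivative is \<open>q\<close> times the identity minus a rank one matrix with trace
  \<open>(s - 1) * q^2\<close>. Its determinant \<open>q^3 - (s - 1) * q^4\<close> collapses to
  \<open>q^4\<close>.\<close>

lemma det_simplex_chart_deriv:
  assumes "\<forall>i. 0 < l$i"
  shows "det (matrix (simplex_chart_deriv l)) = 1 / (1 + (l$1 + l$2 + l$3)) ^ 4"
proof -
  define s where "s = 1 + (l$1 + l$2 + l$3)"
  have "0 < l$1 + l$2 + l$3" using assms by (simp add: add_pos_pos)
  then have s: "s \<noteq> 0" by (simp add: s_def)
  define q where "q = 1 / s"
  have e: "matrix (simplex_chart_deriv l) $ i $ j = (if i = j then q else 0) - l$i * q\<^sup>2" for i j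
    using exhaust_3[of j]
    by (auto simp: matrix_def simplex_chart_deriv_def s_def q_def axis_def power_one_over)
  have "det (matrix (simplex_chart_deriv l)) = q ^ 3 - (l$1 + l$2 + l$3) * q ^ 4"
    unfolding det_3 e by simp algebra
  also have "\<dots> = 1 / s ^ 3 - (s - 1) / s ^ 4"
    by (simp add: q_def s_def power_one_over)
  also have "\<dots> = 1 / s ^ 4"
    using s by (simp add: field_simps power_numeral_reduce)
  finally show ?thesis by (simp add: s_def)
qed

text \<open>The octant is mapped onto the interior of the simplex and then affinely into the
  tetrahedron; the Jacobian is the product of the two determinants.\<close>

lemma nn_integral_tetrahedron:
  fixes f :: "real^3 \<Rightarrow> real" and M :: "real^3^3" and c :: "real^3"
  assumes f: "f \<in> borel_measurable borel" "\<And>x. 0 \<le> f x" and M: "det M \<noteq> 0"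
    and I: "(\<integral>\<^sup>+l. ennreal (\<bar>det M\<bar> / (1 + (l$1 + l$2 + l$3)) ^ 4 * f (c + M *v simplex_chart l)) *
        indicator {l. \<forall>i. 0 < l$i} l \<partial>lborel) = ennreal V" "0 \<le> V"
  shows "(\<integral>\<^sup>+x. ennreal (f x) *
      indicator (convex hull {c, c + column 1 M, c + column 2 M, c + column 3 M}) x \<partial>lborel) = ennreal V"
proof -
  define T :: "(real^3) set" where "T = {l. \<forall>i. 0 < l$i}"
  define C :: "(real^3) set" where "C = convex hull (insert 0 Basis)"
  define A where "A v = c + M *v v" for v
  define F where "F l = \<bar>det M\<bar> / (1 + (l$1 + l$2 + l$3)) ^ 4 * f (c + M *v simplex_chart l)" for l
  have T: "T \<in> sets borel"
    unfolding T_def forall_3 by (intro borel_open open_Collect_conj open_Collect_less continuous_intros)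
  have [measurable]: "(\<lambda>l. simplex_chart l) \<in> borel_measurable borel"
    "(\<lambda>l::real^3. \<bar>det M\<bar> / (1 + (l$1 + l$2 + l$3)) ^ 4) \<in> borel_measurable borel"
    unfolding simplex_chart_def[abs_def]
    by (intro borel_measurable_scaleR borel_measurable_divide borel_measurable_power borel_measurable_const
        borel_measurable_continuous_onI continuous_intros; simp)+
  have "F \<in> borel_measurable borel"
    unfolding F_def[abs_def]
    by (intro borel_measurable_times measurable_compose[OF _ f(1)] borel_measurable_add
        borel_measurable_const measurable_compose[OF _ borel_measurable_continuous_onI[OF matrix_vector_mult_linear_continuous_on]])
      measurable
  then have "((\<lambda>l. F l * indicator T l) has_integral V) UNIV"
  proof (intro nn_integral_has_integral borel_measurable_times borel_measurable_indicator T)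
    show "0 \<le> F l * indicator T l" for l
      using f(2) by (simp add: F_def)
    show "(\<integral>\<^sup>+l. ennreal (F l * indicator T l) \<partial>lborel) = ennreal V"
      unfolding I(1)[symmetric]
      by (intro nn_integral_cong) (simp add: F_def T_def indicator_def)
  qed (use I(2) in auto)
  then have "((\<lambda>l. if l \<in> T then F l else 0) has_integral V) UNIV"
    by (rule has_integral_eq[rotated]) (simp add: indicator_def)
  then have FT: "(F has_integral V) T"
    by (simp only: has_integral_restrict_UNIV)
  have A': "(A has_derivative (*v) M) (at x)" for x
  proof -
    have "(A has_derivative (\<lambda>h. 0 + M *v h)) (at x)"
      unfolding A_def[abs_def]
      by (intro has_derivative_add has_derivative_const linear_imp_has_derivative matrix_vector_mul_linear)
    then show ?thesis by simp
  qed
  have "((\<lambda>l. \<bar>det (matrix ((*v) M \<circ> simplex_chart_deriv l))\<bar> * f ((A \<circ> simplex_chart) l)) has_integral V) T"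
  proof (rule has_integral_eq[OF _ FT])
    fix l assume "l \<in> T"
    then have "\<bar>det (matrix ((*v) M \<circ> simplex_chart_deriv l))\<bar> = \<bar>det M\<bar> / (1 + (l$1 + l$2 + l$3)) ^ 4"
      by (simp add: T_def matrix_compose linear_simplex_chart_deriv det_mul det_simplex_chart_deriv abs_mult)
    then show "F l = \<bar>det (matrix ((*v) M \<circ> simplex_chart_deriv l))\<bar> * f ((A \<circ> simplex_chart) l)"
      by (simp add: F_def A_def)
  qed
  then have "(f has_integral V) ((A \<circ> simplex_chart) ` T)"
  proof (subst (asm) has_integral_change_of_variables_nonneg)
    show "T \<in> sets lebesgue" using T by simp
    show "(A \<circ> simplex_chart has_derivative (*v) M \<circ> simplex_chart_deriv l) (at l within T)" if "l \<in> T" for l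
    proof (rule has_derivative_at_withinI, rule diff_chain_at)
      show "(simplex_chart has_derivative simplex_chart_deriv l) (at l)"
        using that by (intro has_derivative_simplex_chart) (simp add: T_def)
    qed (rule A')
    have "inj A"
      using M det_nz_iff_inj[of "(*v) M"] by (simp add: A_def inj_def)
    then show "inj_on (A \<circ> simplex_chart) T"
      unfolding T_def by (intro comp_inj_on inj_on_simplex_chart) (rule inj_on_subset[OF _ subset_UNIV])
  qed (use f(2) in auto)
  also have "(A \<circ> simplex_chart) ` T = A ` interior C"
    by (simp only: image_comp[symmetric] T_def octant_image_simplex_chart C_def)
  finally have "(f has_integral V) (A ` interior C)" .
  \<comment> \<open>Only the faces are missed, and they are the image of the frontier of a convex
    set, hence negligible.\<close>
  then have "(f has_integral V) (A ` C)"
  proof (subst has_integral_spike_set_eq)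
    have "negligible (A ` frontier C)"
    proof (rule negligible_differentiable_image_negligible)
      show "negligible (frontier C)"
        by (simp add: C_def negligible_convex_frontier)
      show "A differentiable_on frontier C"
        using A' by (intro differentiable_at_imp_differentiable_on) (rule differentiableI)
    qed simp
    moreover have "{x \<in> A ` C - A ` interior C. f x \<noteq> 0} \<subseteq> A ` frontier C"
      using closure_subset[of C] by (auto simp: frontier_def)
    ultimately show "negligible {x \<in> A ` C - A ` interior C. f x \<noteq> 0}"
      by (rule negligible_subset)
    have "{x \<in> A ` interior C - A ` C. f x \<noteq> 0} = {}"
      using interior_subset[of C] by auto
    then show "negligible {x \<in> A ` interior C - A ` C. f x \<noteq> 0}"
      by (simp only: negligible_empty)
  qed
  then have "(\<integral>\<^sup>+x. ennreal (f x) * indicator (A ` C) x \<partial>lborel) = ennreal V"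
    by (intro nn_integral_has_integral_lebesgue' f(2))
  then show ?thesis
    by (simp add: A_def[abs_def] C_def affine_image_std_simplex)
qed

section \<open>Determinants and permanents of order four\<close>

text \<open>Every permutation is uniquely a product of transpositions that place 1, then 2, then 3.
  The 24 explicit terms serve both the determinant and the permanent.\<close>

lemma sum_permutations_4:
  "sum f {p. p permutes (UNIV :: 4 set)} =
    (\<Sum>a\<in>{1,2,3,4}. \<Sum>b\<in>{2,3,4}. \<Sum>c\<in>{3,4}. f (Transposition.transpose 1 a \<circ> (Transposition.transpose 2 b \<circ> (Transposition.transpose 3 c \<circ> id))))"
proof -
  have f: "finite {2::4, 3, 4}" "1 \<notin> {2::4, 3, 4}" "finite {3::4, 4}" "2 \<notin> {3::4, 4}"
    "finite {4::4}" "3 \<notin> {4::4}"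
    by auto
  show ?thesis
    unfolding UNIV_4 sum_over_permutations_insert[OF f(1,2)] sum_over_permutations_insert[OF f(3,4)]
      sum_over_permutations_insert[OF f(5,6)] permutes_sing
    by (simp only: singleton_conv sum.insert sum.empty finite.emptyI empty_iff not_False_eq_True add_0_right)
qed

lemma prod_4: "prod f (UNIV :: 4 set) = f 1 * f 2 * f 3 * f 4"
  unfolding UNIV_4 by (simp add: mult.assoc)

lemma sign_transpose3:
  "sign (Transposition.transpose (1::4) a \<circ> (Transposition.transpose 2 b \<circ> (Transposition.transpose 3 c \<circ> id))) =
    (if 1 = a then 1 else -1) * ((if 2 = b then 1 else -1) * (if 3 = c then 1 else -1))"
  by (simp only: sign_compose permutation_compose permutation_swap_id permutation_id sign_swap_id sign_id
      comp_id)

lemma det_4: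
  "det (A :: 'a::comm_ring_1^4^4) =
    A$1$1 * (A$2$2 * (A$3$3 * A$4$4 - A$3$4 * A$4$3) - A$2$3 * (A$3$2 * A$4$4 - A$3$4 * A$4$2) +
      A$2$4 * (A$3$2 * A$4$3 - A$3$3 * A$4$2)) -
    A$1$2 * (A$2$1 * (A$3$3 * A$4$4 - A$3$4 * A$4$3) - A$2$3 * (A$3$1 * A$4$4 - A$3$4 * A$4$1) +
      A$2$4 * (A$3$1 * A$4$3 - A$3$3 * A$4$1)) +
    A$1$3 * (A$2$1 * (A$3$2 * A$4$4 - A$3$4 * A$4$2) - A$2$2 * (A$3$1 * A$4$4 - A$3$4 * A$4$1) +
      A$2$4 * (A$3$1 * A$4$2 - A$3$2 * A$4$1)) -
    A$1$4 * (A$2$1 * (A$3$2 * A$4$3 - A$3$3 * A$4$2) - A$2$2 * (A$3$1 * A$4$3 - A$3$3 * A$4$1) +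
      A$2$3 * (A$3$1 * A$4$2 - A$3$2 * A$4$1))"
  unfolding det_def sum_permutations_4 sign_transpose3 prod_4 comp_apply id_apply
  by (simp add: Transposition.transpose_def algebra_simps)

lemma permanent_4:
  "permanent (A :: 'a::comm_ring_1^4^4) =
    A$1$1 * (A$2$2 * (A$3$3 * A$4$4 + A$3$4 * A$4$3) + A$2$3 * (A$3$2 * A$4$4 + A$3$4 * A$4$2) +
      A$2$4 * (A$3$2 * A$4$3 + A$3$3 * A$4$2)) +
    A$1$2 * (A$2$1 * (A$3$3 * A$4$4 + A$3$4 * A$4$3) + A$2$3 * (A$3$1 * A$4$4 + A$3$4 * A$4$1) +
      A$2$4 * (A$3$1 * A$4$3 + A$3$3 * A$4$1)) +
    A$1$3 * (A$2$1 * (A$3$2 * A$4$4 + A$3$4 * A$4$2) + A$2$2 * (A$3$1 * A$4$4 + A$3$4 * A$4$1) +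
      A$2$4 * (A$3$1 * A$4$2 + A$3$2 * A$4$1)) +
    A$1$4 * (A$2$1 * (A$3$2 * A$4$3 + A$3$3 * A$4$2) + A$2$2 * (A$3$1 * A$4$3 + A$3$3 * A$4$1) +
      A$2$3 * (A$3$1 * A$4$2 + A$3$2 * A$4$1))"
  unfolding permanent_def sum_permutations_4 prod_4 comp_apply id_apply
  by (simp add: Transposition.transpose_def algebra_simps)

lemma vector_4 [simp]:
  "(vector [a, b, c, d] :: 'a::zero^4) $ 1 = a" "(vector [a, b, c, d] :: 'a^4) $ 2 = b"
  "(vector [a, b, c, d] :: 'a^4) $ 3 = c" "(vector [a, b, c, d] :: 'a^4) $ 4 = d"
  unfolding vector_def by simp_all

text \<open>The matrix is a group matrix of the Klein four-group, and the factors are, up to sign,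
  its eigenvalues. The factor \<open>x + y + z\<close>, equal to 1 on \<open>Delta\<close>, keeps
  the identity homogeneous.\<close>

lemma det_gram: "det (gram (x, y, z)) = - ((x + y + z) * (y + z - x) * (z + x - y) * (x + y - z))"
  unfolding det_4 by (simp add: algebra_simps)

lemma permanent_gram: "permanent (gram (x, y, z)) = (x\<^sup>2 + y\<^sup>2 + z\<^sup>2)\<^sup>2"
  unfolding permanent_4 by (simp add: algebra_simps power2_eq_square)

section \<open>The Klein model\<close>

definition klein_density :: "real^3 \<Rightarrow> real" where
  "klein_density x = (if x \<bullet> x < 1 then 1 / (1 - x \<bullet> x)\<^sup>2 else 0)"

lemma klein_density_nonneg: "0 \<le> klein_density x"
  by (simp add: klein_density_def)

lemma borel_measurable_klein_density [measurable]: "klein_density \<in> borel_measurable borel"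
  unfolding klein_density_def[abs_def] by measurable

text \<open>An instance of the matrix determinant lemma; for
  \<open>r = 1 / (1 - x \<bullet> x)\<close> the matrix is the hyperbolic metric in the Klein
  chart.\<close>

lemma det_diagonal_plus_rank_one:
  fixes x :: "real^3"
  shows "det (\<chi> i j. (if i = j then r else 0) + x$i * x$j * r\<^sup>2) = r ^ 3 + r ^ 4 * (x \<bullet> x)"
  unfolding det_3 inner_vec_def sum_3 by simp algebra

context
  fixes B :: "'v::real_vector \<Rightarrow> 'v \<Rightarrow> real" and f :: "3 \<Rightarrow> 'v" and n :: 'v
  assumes bilinear: "bilinear B" and sym: "\<And>u w. B u w = B w u" and frame: "orthonormal_frame B f n"
begin

private lemmas B_simps = bilinear_ladd[OF bilinear] bilinear_radd[OF bilinear]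
  bilinear_lmul[OF bilinear] bilinear_rmul[OF bilinear]
  bilinear_lsub[OF bilinear] bilinear_rsub[OF bilinear]

private lemma B_frame:
  "B (f i) (f j) = (if i = j then -1 else 0)" "B (f i) n = 0" "B n (f i) = 0" "B n n = 1"
  using frame sym[of n "f i"] unfolding orthonormal_frame_def by simp_all

private lemma klein_chart_3: "klein_chart f n x = x$1 *\<^sub>R f 1 + x$2 *\<^sub>R f 2 + x$3 *\<^sub>R f 3 + n"
  by (simp add: klein_chart_def sum_3)

lemma B_klein_chart: "B (klein_chart f n x) (klein_chart f n y) = 1 - x \<bullet> y"
  by (simp add: klein_chart_3 B_simps B_frame inner_vec_def sum_3)

private lemma B_frame_klein_chart: "B (f i) (klein_chart f n x) = - x$i"
  using exhaust_3[of i] by (auto simp: klein_chart_3 B_simps B_frame)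

lemma B_n_klein_chart: "B n (klein_chart f n x) = 1"
  by (simp add: klein_chart_3 B_simps B_frame)

text \<open>The chart meets each line at most once: pairing with \<open>n\<close> forces the scalar
  to be 1, and pairing with \<open>f i\<close> recovers the coordinates.\<close>

lemma klein_chart_inj:
  assumes "klein_chart f n y = c *\<^sub>R klein_chart f n x"
  shows "y = x"
proof -
  have "c = 1"
    using B_n_klein_chart[of y] B_n_klein_chart[of x] assms by (simp add: B_simps)
  then have "- y$i = - x$i" for i
    using assms by (metis B_frame_klein_chart scaleR_one)
  then show ?thesis by (simp add: vec_eq_iff)
qed

lemma hyperbolic_measure_eq: "hyperbolic_measure B f n = density lborel (\<lambda>x. ennreal (klein_density x))"
proof -
  have "(let p = klein_chart f n x in if B p p > 0
      then ennreal (sqrt (det ((\<chi> i j. hyperbolic_metric B p (f i) (f j)) :: real^3^3))) else 0) =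
      ennreal (klein_density x)" for x
  proof (cases "x \<bullet> x < 1")
    case True
    define p where "p = klein_chart f n x"
    define r where "r = 1 / (1 - x \<bullet> x)"
    have p: "B p p = 1 - x \<bullet> x" by (simp add: p_def B_klein_chart)
    have r: "0 < r" "(1 - x \<bullet> x) * r = 1" using True by (simp_all add: r_def)
    have "hyperbolic_metric B p (f i) (f j) = (if i = j then r else 0) + x$i * x$j * r\<^sup>2" for i j
    proof -
      have fp: "B (f i) p = - x$i" "B p (f i) = - x$i" for i
        using sym[of p "f i"] by (simp_all add: p_def B_frame_klein_chart)
      have "hyperbolic_metric B p (f i) (f j) =
          - (B (f i - (- x$i * r) *\<^sub>R p) (f j - (- x$j * r) *\<^sub>R p) * r)"
        unfolding hyperbolic_metric_def fp p by (simp add: r_def)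
      also have "\<dots> = - (((if i = j then -1 else 0) - 2 * x$i * x$j * r + x$i * x$j * r * ((1 - x \<bullet> x) * r)) * r)"
        by (simp add: B_simps fp p B_frame algebra_simps)
      finally show ?thesis
        unfolding r(2) by (cases "i = j") (simp_all add: algebra_simps power2_eq_square)
    qed
    then have "det ((\<chi> i j. hyperbolic_metric B p (f i) (f j)) :: real^3^3) = r ^ 3 + r ^ 4 * (x \<bullet> x)"
      by (simp only: det_diagonal_plus_rank_one)
    \<comment> \<open>The relation \<open>(1 - x \<bullet> x) * r = 1\<close> turns
      \<open>r ^ 3\<close> into \<open>r ^ 4 * (1 - x \<bullet> x)\<close>.\<close>
    also have "\<dots> = (r\<^sup>2)\<^sup>2"
      using r(2) by algebra
    finally have d: "det ((\<chi> i j. hyperbolic_metric B p (f i) (f j)) :: real^3^3) = (r\<^sup>2)\<^sup>2" .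
    have "sqrt (det ((\<chi> i j. hyperbolic_metric B p (f i) (f j)) :: real^3^3)) = r\<^sup>2"
      unfolding d by (simp only: real_sqrt_abs) simp
    then show ?thesis
      using True by (simp add: p_def[symmetric] p klein_density_def r_def power_one_over)
  qed (simp add: B_klein_chart klein_density_def Let_def)
  then show ?thesis
    unfolding hyperbolic_measure_def by simp
qed

lemma volume_in_frame_eq:
  "volume_in_frame B f n v = enn2real (\<integral>\<^sup>+x. ennreal (klein_density x) *
    indicator (convex hull {x. \<exists>i. klein_chart f n x \<in> v i}) x \<partial>lborel)"
  if "convex hull {x. \<exists>i. klein_chart f n x \<in> v i} \<in> sets borel"
  unfolding volume_in_frame_def hyperbolic_measure_eq measure_def
  using that by (subst emeasure_density) auto

lemma frame_coordinates: "\<exists>a h. w = (\<Sum>i\<in>UNIV. a$i *\<^sub>R f i) + h *\<^sub>R n" for w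
proof -
  let ?L = "\<lambda>(a :: real^3, h). (\<Sum>i\<in>UNIV. a$i *\<^sub>R f i) + h *\<^sub>R n"
  have "linear ?L"
    by (rule linearI) (auto simp: scaleR_add_left sum.distrib scaleR_add_right scaleR_sum_right)
  then have "subspace (range ?L)"
    by (rule linear_subspace_image[OF _ subspace_UNIV])
  moreover have "insert n (range f) \<subseteq> range ?L"
  proof -
    have "n = ?L (0, 1)" by simp
    moreover have "f i = ?L (axis i 1, 0)" for i
      by (simp add: axis_def if_distrib[of "\<lambda>c. c *\<^sub>R _"] cong: if_cong)
    ultimately show ?thesis by blast
  qed
  ultimately have "span (insert n (range f)) \<subseteq> range ?L"
    by (rule span_minimal[rotated])
  then have "w \<in> range ?L"
    using frame by (auto simp: orthonormal_frame_def)
  then show ?thesis by auto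
qed

text \<open>The form is negative definite on the span of the \<open>f i\<close>, so a nonzero null
  vector has a nonzero \<open>n\<close> component, by which it can be divided.\<close>

lemma null_vector_chart:
  assumes "w \<noteq> 0" "B w w = 0"
  obtains k x where "k \<noteq> 0" "w = k *\<^sub>R klein_chart f n x" "x \<bullet> x = 1"
proof -
  obtain a h where w: "w = (\<Sum>i\<in>UNIV. a$i *\<^sub>R f i) + h *\<^sub>R n"
    using frame_coordinates by blast
  have "B w w = h\<^sup>2 - a \<bullet> a"
    by (simp add: w sum_3 B_simps B_frame inner_vec_def power2_eq_square)
  with assms have ah: "a \<bullet> a = h\<^sup>2" by simp
  have h: "h \<noteq> 0"
  proof
    assume "h = 0"
    with ah have "a = 0" by simp
    with \<open>h = 0\<close> have "w = 0" by (simp add: w)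
    with assms(1) show False ..
  qed
  show ?thesis
  proof
    show "w = h *\<^sub>R klein_chart f n ((1 / h) *\<^sub>R a)"
      using h by (simp add: w klein_chart_def scaleR_add_right scaleR_sum_right)
    show "((1 / h) *\<^sub>R a) \<bullet> ((1 / h) *\<^sub>R a) = 1"
      using h by (simp add: ah power2_eq_square)
  qed (rule h)
qed

text \<open>The zero diagonal makes the representatives null vectors, which are multiples of points
  on the unit sphere. The scalars \<open>k i\<close> may have either sign. Each vertex line meets
  the chart in exactly one point.\<close>

lemma ideal_tetrahedron_chart:
  assumes T: "ideal_tetrahedron B v" and G: "is_gram_matrix B v G"
    and diag: "\<And>i. G$i$i = 0"
  obtains x k where "\<And>i. x i \<bullet> x i = 1" "\<And>i. k i \<noteq> (0::real)"
    "\<And>i j. G$i$j = k i * k j * (1 - x i \<bullet> x j)"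
    "{y. \<exists>i. klein_chart f n y \<in> v i} = range x"
proof -
  obtain u where u: "\<And>i. u i \<in> v i" "\<And>i. u i \<noteq> 0" "\<And>i j. G$i$j = B (u i) (u j)"
    using G unfolding is_gram_matrix_def by blast
  have "\<exists>k x. k \<noteq> 0 \<and> u i = k *\<^sub>R klein_chart f n x \<and> x \<bullet> x = 1" for i
    using null_vector_chart[of "u i"] u(2,3) diag by metis
  then obtain k x where kx: "\<And>i. k i \<noteq> 0" "\<And>i. u i = k i *\<^sub>R klein_chart f n (x i)"
      "\<And>i. x i \<bullet> x i = 1"
    by metis
  have v: "klein_chart f n y \<in> v i \<longleftrightarrow> y = x i" for y i
  proof -
    obtain p where p: "v i = span {p}"
      using T unfolding ideal_tetrahedron_def ideal_point_def by blast
    obtain c where c: "u i = c *\<^sub>R p"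
      using u(1)[of i] p by (auto simp: span_singleton)
    have "c \<noteq> 0" using u(2)[of i] c by auto
    show ?thesis
    proof
      assume "klein_chart f n y \<in> v i"
      then obtain d where "klein_chart f n y = d *\<^sub>R p"
        using p by (auto simp: span_singleton)
      also have "p = (k i / c) *\<^sub>R klein_chart f n (x i)"
        using c kx(2)[of i] \<open>c \<noteq> 0\<close> by (metis divide_inverse_commute inverse_eq_divide scaleR_scaleR scaleR_one left_inverse)
      finally show "y = x i"
        by (intro klein_chart_inj[of _ "d * (k i / c)"]) simp
    next
      assume "y = x i"
      then have "klein_chart f n y = (c / k i) *\<^sub>R p"
        using c kx(1,2)[of i] by (metis divide_inverse_commute scaleR_scaleR scaleR_one left_inverse)
      then show "klein_chart f n y \<in> v i"
        using p by (auto simp: span_singleton)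
    qed
  qed
  show ?thesis
  proof
    show "G$i$j = k i * k j * (1 - x i \<bullet> x j)" for i j
      unfolding u(3) kx(2) by (simp add: B_simps B_klein_chart)
    show "{y. \<exists>i. klein_chart f n y \<in> v i} = range x"
      by (auto simp: v)
  qed (use kx in auto)
qed

end

text \<open>The vertices of a box inscribed in the unit sphere, alternately chosen, realise every point of
  \<open>\<Delta>\<close>; the squared half-edges of the box are \<open>1 - 2x\<close>, \<open>1 - 2y\<close>, \<open>1 - 2z\<close>.\<close>

lemma represents_exists:
  fixes B :: "'v::real_vector \<Rightarrow> 'v \<Rightarrow> real"
  assumes bilinear: "bilinear B" and sym: "\<And>u w. B u w = B w u" and frame: "orthonormal_frame B f n"
    and T: "T \<in> Delta"
  shows "\<exists>v. represents B T v"
proof -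
  obtain x y z where xyz: "T = (x, y, z)" by (cases T)
  have sum: "x + y + z = 1" and le: "x \<le> 1/2" "y \<le> 1/2" "z \<le> 1/2"
    using T by (auto simp: Delta_def xyz)
  define a b c where "a = sqrt (1 - 2 * x)" and "b = sqrt (1 - 2 * y)" and "c = sqrt (1 - 2 * z)"
  have sq: "a * a = 1 - 2 * x" "b * b = 1 - 2 * y" "c * c = 1 - 2 * z"
    using le by (simp_all add: a_def b_def c_def)
  define P :: "real^3^4" where "P = vector [vector [a, b, c], vector [a, - b, - c],
    vector [- a, b, - c], vector [- a, - b, c]]"
  \<comment> \<open>The rows of \<open>P\<close> are unit vectors with
    \<open>1 - P$1 \<bullet> P$2 = 4 * x\<close> and likewise for the other pairs; the factor 1/2
    removes the 4.\<close>
  define u where "u i = (1/2) *\<^sub>R klein_chart f n (P$i)" for i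
  define v where "v i = span {u i}" for i
  note B_simps = bilinear_ladd[OF bilinear] bilinear_radd[OF bilinear]
    bilinear_lmul[OF bilinear] bilinear_rmul[OF bilinear]
  have Bu: "B (u i) (u j) = (1 - P$i \<bullet> P$j) / 4" for i j
    by (simp add: u_def B_simps B_klein_chart[OF bilinear sym frame])
  have gram: "gram T $ i $ j = B (u i) (u j)" for i j
  proof -
    have "\<forall>i j. gram T $ i $ j = B (u i) (u j)"
      unfolding Bu xyz forall_4 using sum
      by (simp add: P_def inner_vec_def sum_3 sq)
    then show ?thesis by blast
  qed
  have nz: "u i \<noteq> 0" for i
  proof
    assume "u i = 0"
    then have "klein_chart f n (P$i) = 0" by (simp add: u_def)
    with B_n_klein_chart[OF bilinear sym frame, of "P$i"] show False
      by (simp add: bilinear_rzero[OF bilinear])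
  qed
  have null: "B (u i) (u i) = 0" for i
    unfolding gram[symmetric] xyz using exhaust_4[of i] by auto
  have "ideal_tetrahedron B v"
    unfolding ideal_tetrahedron_def ideal_point_def v_def using nz null by blast
  moreover have "is_gram_matrix B v (gram T)"
    unfolding is_gram_matrix_def v_def using nz gram span_base by blast
  moreover have "doubly_stochastic (gram T)"
    unfolding doubly_stochastic_def xyz forall_4 sum_4 using sum le by simp
  ultimately show ?thesis
    unfolding represents_def by blast
qed

section \<open>The volume of a tetrahedron with vertices on the unit sphere\<close>

text \<open>The edges from \<open>X 4\<close> are the columns; \<open>vector\<close> lists rows,
  hence the exchanged indices.\<close>

definition edge_matrix :: "(4 \<Rightarrow> real^3) \<Rightarrow> real^3^3" where
  "edge_matrix X = (\<chi> i j. (vector [X 1 - X 4, X 2 - X 4, X 3 - X 4] :: real^3^3) $ j $ i)"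

lemma hull_edge_matrix:
  "{X 4, X 4 + column 1 (edge_matrix X), X 4 + column 2 (edge_matrix X), X 4 + column 3 (edge_matrix X)} =
    range X"
proof -
  have "X 4 + column 1 (edge_matrix X) = X 1" "X 4 + column 2 (edge_matrix X) = X 2"
      "X 4 + column 3 (edge_matrix X) = X 3"
    by (simp_all add: edge_matrix_def column_def vec_eq_iff)
  then show ?thesis
    by (auto simp: UNIV_4)
qed

text \<open>With \<open>N\<close> the matrix of rows \<open>(X i, 1)\<close> and \<open>J = diag(-1, -1, -1, 1)\<close>, the matrix
  \<open>[1 - \<langle>X i, X j\<rangle>]\<close> is \<open>N J N\<^sup>T\<close>.\<close>

lemma det_edge_matrix_squared:
  fixes X :: "4 \<Rightarrow> real^3"
  assumes "\<And>i. X i \<bullet> X i = 1"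
  defines "h \<equiv> \<lambda>i j. 1 - X i \<bullet> X j"
  shows "(det (edge_matrix X))\<^sup>2 =
    4 * (h 1 2 * h 3 4) * (h 1 4 * h 2 3) - (h 1 2 * h 3 4 + h 1 4 * h 2 3 - h 1 3 * h 2 4)\<^sup>2"
proof -
  define N :: "real^4^4" where "N = (\<chi> i. vector [X i $ 1, X i $ 2, X i $ 3, 1])"
  define J :: "real^4^4" where "J = vector [vector [-1, 0, 0, 0], vector [0, -1, 0, 0],
    vector [0, 0, -1, 0], vector [0, 0, 0, 1]]"
  have entry: "(N ** J ** Finite_Cartesian_Product.transpose N) $ i $ j = h i j" for i j
    by (simp add: matrix_matrix_mult_def sum_4 N_def J_def Finite_Cartesian_Product.transpose_def h_def
        inner_vec_def sum_3)
  have h: "h i i = 0" "h 2 1 = h 1 2" "h 3 1 = h 1 3" "h 4 1 = h 1 4" "h 3 2 = h 2 3" "h 4 2 = h 2 4"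
      "h 4 3 = h 3 4" for i
    by (simp_all add: h_def assms inner_commute)
  have "det J = -1"
    unfolding det_4 by (simp add: J_def)
  then have "det (N ** J ** Finite_Cartesian_Product.transpose N) = - (det N)\<^sup>2"
    by (simp add: det_mul power2_eq_square)
  moreover have "det (N ** J ** Finite_Cartesian_Product.transpose N) =
      - (4 * (h 1 2 * h 3 4) * (h 1 4 * h 2 3) - (h 1 2 * h 3 4 + h 1 4 * h 2 3 - h 1 3 * h 2 4)\<^sup>2)"
    unfolding det_4 entry h by algebra
  \<comment> \<open>Subtracting the last row of \<open>N\<close> from the others leaves the edges.
    The sign does not matter, since only squares are compared.\<close>
  moreover have "det N = - det (edge_matrix X) \<or> det N = det (edge_matrix X)"
    unfolding det_4 det_3 N_def edge_matrix_def by (simp, algebra)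
  then have "(det N)\<^sup>2 = (det (edge_matrix X))\<^sup>2"
    by auto
  ultimately show ?thesis by simp
qed

text \<open>The absolute determinant of the edge matrix is
  \<open>2 * m * sin A * sin B * sin C\<close>, so the scale \<open>m\<close> and the sines cancel
  against the octant integral.\<close>

lemma nn_integral_klein_density_tetrahedron:
  fixes X :: "4 \<Rightarrow> real^3" and A B C m :: real
  assumes unit: "\<And>i. X i \<bullet> X i = 1"
    and angles: "0 < A" "0 < B" "0 < C" "A + B + C = pi" and m: "0 < m"
    and p: "(1 - X 1 \<bullet> X 2) * (1 - X 3 \<bullet> X 4) = m * (sin A)\<^sup>2"
    and q: "(1 - X 1 \<bullet> X 3) * (1 - X 2 \<bullet> X 4) = m * (sin B)\<^sup>2"
    and r: "(1 - X 1 \<bullet> X 4) * (1 - X 2 \<bullet> X 3) = m * (sin C)\<^sup>2"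
  shows "(\<integral>\<^sup>+x. ennreal (klein_density x) * indicator (convex hull (range X)) x \<partial>lborel) =
    ennreal (lobachevsky A + lobachevsky B + lobachevsky C)"
proof -
  define M where "M = edge_matrix X"
  define h where "h i j = 1 - X i \<bullet> X j" for i j
  have s: "0 < sin A" "0 < sin B" "0 < sin C"
    using angles by (auto intro!: sin_gt_zero)
  have prods: "h 1 2 * h 3 4 = m * (sin A)\<^sup>2" "h 1 3 * h 2 4 = m * (sin B)\<^sup>2"
      "h 1 4 * h 2 3 = m * (sin C)\<^sup>2"
    using p q r by (simp_all add: h_def)
  have h0: "0 \<le> h i j" for i j
    using norm_cauchy_schwarz[of "X i" "X j"] unit by (simp add: h_def norm_eq_sqrt_inner)
  \<comment> \<open>Cauchy-Schwarz gives only nonnegative entries; the nonzero products make all six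
    positive.\<close>
  have h: "0 < h 1 2" "0 < h 1 3" "0 < h 1 4" "0 < h 2 3" "0 < h 2 4" "0 < h 3 4"
    using prods m s h0 by (smt (verit) mult_eq_0_iff zero_less_mult_iff zero_less_power)+
  have "(det M)\<^sup>2 = (2 * m * sin A * sin B * sin C)\<^sup>2"
    using det_edge_matrix_squared[of X, OF unit, folded h_def M_def] sin_law_of_cosines[OF angles]
      sin_cos_squared_add[of B] unfolding prods by algebra
  then have D: "\<bar>det M\<bar> = 2 * m * sin A * sin B * sin C"
    using m s by (simp add: power2_eq_iff abs_if split: if_splits) (smt (verit) mult_pos_pos)
  define Q where "Q l = h 1 2 * l$1 * l$2 + h 1 3 * l$1 * l$3 + h 1 4 * l$1 +
    h 2 3 * l$2 * l$3 + h 2 4 * l$2 + h 3 4 * l$3" for l :: "real^3"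
  have kd: "\<bar>det M\<bar> / (1 + (l$1 + l$2 + l$3)) ^ 4 * klein_density (X 4 + M *v simplex_chart l) =
      \<bar>det M\<bar> / 4 * (1 / (Q l)\<^sup>2)" if l: "\<forall>i. 0 < l$i" for l
  proof -
    define t where "t = 1 + (l$1 + l$2 + l$3)"
    have "0 < l$1 + l$2 + l$3" using l by (simp add: add_pos_pos)
    then have t: "0 < t" by (simp add: t_def)
    have Q: "0 < Q l"
      unfolding Q_def using l h by (intro add_pos_pos mult_pos_pos) auto
    define y where "y = X 4 + M *v simplex_chart l"
    \<comment> \<open>Clearing the denominator gives
      \<open>1 - y \<bullet> y = 2 * Q l / t^2\<close>. The density then contributes
      \<open>t ^ 4\<close>, which cancels the Jacobian.\<close>
    have "t *\<^sub>R y = l$1 *\<^sub>R X 1 + l$2 *\<^sub>R X 2 + l$3 *\<^sub>R X 3 + X 4"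
      using t unfolding y_def simplex_chart_def t_def[symmetric] M_def edge_matrix_def
      by (simp add: vec_eq_iff forall_3 matrix_vector_mult_def sum_3 field_simps)
        (simp add: t_def algebra_simps)
    then have "(t *\<^sub>R y) \<bullet> (t *\<^sub>R y) = t\<^sup>2 - 2 * Q l"
      by (simp add: inner_add_left inner_add_right unit Q_def h_def t_def power2_eq_square inner_commute
          algebra_simps)
    then have yy: "1 - y \<bullet> y = 2 * Q l / t\<^sup>2"
      using t by (simp add: field_simps power2_eq_square)
    then have "y \<bullet> y < 1"
      using t Q by (smt (verit) divide_pos_pos zero_less_power)
    then have "klein_density y = t ^ 4 / (4 * (Q l)\<^sup>2)"
      using yy by (simp add: klein_density_def power_divide power_mult_distrib)
    then show ?thesis
      using t by (simp add: t_def[symmetric] y_def[symmetric])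
  qed
  have "(\<integral>\<^sup>+x. ennreal (klein_density x) *
      indicator (convex hull {X 4, X 4 + column 1 M, X 4 + column 2 M, X 4 + column 3 M}) x \<partial>lborel) =
    ennreal (lobachevsky A + lobachevsky B + lobachevsky C)"
  proof (rule nn_integral_tetrahedron)
    show "det M \<noteq> 0"
      using D m s by auto
    have "(\<integral>\<^sup>+l. ennreal (\<bar>det M\<bar> / (1 + (l$1 + l$2 + l$3)) ^ 4 * klein_density (X 4 + M *v simplex_chart l)) *
        indicator {l. \<forall>i. 0 < l$i} l \<partial>lborel) =
      (\<integral>\<^sup>+l. ennreal (\<bar>det M\<bar> / 4) * (ennreal (1 / (Q l)\<^sup>2) * indicator {l. \<forall>i. 0 < l$i} l) \<partial>lborel)"
    proof (rule nn_integral_cong)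
      fix l :: "real^3"
      show "ennreal (\<bar>det M\<bar> / (1 + (l$1 + l$2 + l$3)) ^ 4 * klein_density (X 4 + M *v simplex_chart l)) *
          indicator {l. \<forall>i. 0 < l$i} l =
        ennreal (\<bar>det M\<bar> / 4) * (ennreal (1 / (Q l)\<^sup>2) * indicator {l. \<forall>i. 0 < l$i} l)"
      proof (cases "\<forall>i. 0 < l$i")
        case True
        show ?thesis
          unfolding kd[OF True] by (subst ennreal_mult') (simp_all add: mult.assoc)
      qed simp
    qed
    also have "\<dots> = ennreal (\<bar>det M\<bar> / 4) * (\<integral>\<^sup>+l. ennreal (1 / (Q l)\<^sup>2) * indicator {l. \<forall>i. 0 < l$i} l \<partial>lborel)"
    proof (rule nn_integral_cmult)
      have "Q \<in> borel_measurable borel"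
        unfolding Q_def by (intro borel_measurable_continuous_onI continuous_intros)
      moreover have "{l::real^3. \<forall>i. 0 < l$i} \<in> sets borel"
        unfolding forall_3
        by (intro borel_open open_Collect_conj open_Collect_less continuous_intros)
      ultimately show "(\<lambda>l. ennreal (1 / (Q l)\<^sup>2) * indicator {l. \<forall>i. 0 < l$i} l) \<in> borel_measurable lborel"
        by simp
    qed
    also have "(\<integral>\<^sup>+l. ennreal (1 / (Q l)\<^sup>2) * indicator {l. \<forall>i. 0 < l$i} l \<partial>lborel) =
        ennreal (2 * (lobachevsky A + lobachevsky B + lobachevsky C) / (m * sin A * sin B * sin C))"
      unfolding Q_def by (rule nn_integral_octant[OF angles m h prods])
    also have "ennreal (\<bar>det M\<bar> / 4) * \<dots> =
        ennreal (\<bar>det M\<bar> / 4 * (2 * (lobachevsky A + lobachevsky B + lobachevsky C) / (m * sin A * sin B * sin C)))"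
      by (rule ennreal_mult'[symmetric]) simp
    also have "\<bar>det M\<bar> / 4 * (2 * (lobachevsky A + lobachevsky B + lobachevsky C) / (m * sin A * sin B * sin C)) =
        lobachevsky A + lobachevsky B + lobachevsky C"
      unfolding D using m s by (simp add: field_simps)
    finally show "(\<integral>\<^sup>+l. ennreal (\<bar>det M\<bar> / (1 + (l$1 + l$2 + l$3)) ^ 4 *
        klein_density (X 4 + M *v simplex_chart l)) * indicator {l. \<forall>i. 0 < l$i} l \<partial>lborel) =
      ennreal (lobachevsky A + lobachevsky B + lobachevsky C)" .
  qed (use lobachevsky_sum_nonneg[OF angles] in \<open>auto intro: borel_measurable_klein_density klein_density_nonneg\<close>)
  then show ?thesis
    by (simp only: M_def hull_edge_matrix)
qed

section \<open>Triangles and the cubic\<close>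

text \<open>For \<open>w = y^2 + z^2 - x^2\<close>, \<open>E\<close> is sixteen times the squared
  area of the triangle with sides \<open>x\<close>, \<open>y\<close>, \<open>z\<close>. Being
  symmetric, it serves all three angles.\<close>

lemma heron_cos_sin:
  fixes y z w E :: real
  assumes "0 < y" "0 < z" "0 < E" and E: "4 * y\<^sup>2 * z\<^sup>2 - w\<^sup>2 = E"
  defines "A \<equiv> arccos (w / (2 * y * z))"
  shows "0 < A" "A < pi" "cos A = w / (2 * y * z)" "sin A = sqrt E / (2 * y * z)"
proof -
  define k where "k = w / (2 * y * z)"
  have yz: "0 < 2 * y * z" using assms by simp
  have w: "w = k * (2 * y * z)"
    using assms(1,2) by (simp add: k_def)
  have "(1 - k\<^sup>2) * (2 * y * z)\<^sup>2 = 4 * y\<^sup>2 * z\<^sup>2 - (k * (2 * y * z))\<^sup>2"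
    by algebra
  then have "(1 - k\<^sup>2) * (2 * y * z)\<^sup>2 = E"
    by (simp only: E w[symmetric])
  then have k: "1 - k\<^sup>2 = E / (2 * y * z)\<^sup>2"
    by (rule eq_divide_imp[rotated]) (use assms(1,2) in simp)
  moreover have "0 < E / (2 * y * z)\<^sup>2"
    using assms(1-3) by simp
  ultimately have "k\<^sup>2 < 1" by linarith
  then have "\<bar>k\<bar> < 1" by (simp add: abs_square_less_1)
  then have k1: "-1 < k" "k < 1" by auto
  show "0 < A" "A < pi"
    using arccos_lt_bounded[OF k1] by (simp_all add: A_def k_def)
  show "cos A = w / (2 * y * z)"
    using k1 by (simp add: A_def k_def[symmetric])
  have "sin A = sqrt (1 - k\<^sup>2)"
    using k1 by (simp add: A_def k_def[symmetric] sin_arccos)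
  also have "\<dots> = sqrt E / (2 * y * z)"
    unfolding k real_sqrt_divide using yz by (simp only: real_sqrt_abs abs_of_pos)
  finally show "sin A = sqrt E / (2 * y * z)" .
qed

lemma triangle_angles:
  fixes x y z :: real
  assumes pos: "0 < x" "0 < y" "0 < z" and strict: "x < y + z" "y < z + x" "z < x + y"
  defines "A \<equiv> arccos ((- x\<^sup>2 + y\<^sup>2 + z\<^sup>2) / (2 * y * z))"
    and "B \<equiv> arccos ((x\<^sup>2 - y\<^sup>2 + z\<^sup>2) / (2 * x * z))"
    and "C \<equiv> arccos ((x\<^sup>2 + y\<^sup>2 - z\<^sup>2) / (2 * x * y))"
  shows "0 < A" "0 < B" "0 < C" "A + B + C = pi"
    and "\<exists>e>0. x = e * sin A \<and> y = e * sin B \<and> z = e * sin C"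
proof -
  define E where "E = (x + y + z) * (y + z - x) * (z + x - y) * (x + y - z)"
  have E: "0 < E" unfolding E_def using assms by (intro mult_pos_pos) auto
  have "4 * y\<^sup>2 * z\<^sup>2 - (- x\<^sup>2 + y\<^sup>2 + z\<^sup>2)\<^sup>2 = E" "4 * x\<^sup>2 * z\<^sup>2 - (x\<^sup>2 - y\<^sup>2 + z\<^sup>2)\<^sup>2 = E"
    "4 * x\<^sup>2 * y\<^sup>2 - (x\<^sup>2 + y\<^sup>2 - z\<^sup>2)\<^sup>2 = E"
    unfolding E_def by algebra+
  note A = heron_cos_sin[OF pos(2,3) E this(1), folded A_def]
    and B = heron_cos_sin[OF pos(1,3) E this(2), folded B_def]
    and C = heron_cos_sin[OF pos(1,2) E this(3), folded C_def]
  show "0 < A" "0 < B" "0 < C" by fact+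
  have sE: "(sqrt E)\<^sup>2 = E" using E by simp
  have "sin (A + B) = sqrt E * ((x\<^sup>2 - y\<^sup>2 + z\<^sup>2) + (- x\<^sup>2 + y\<^sup>2 + z\<^sup>2)) / (4 * x * y * z\<^sup>2)"
    unfolding sin_add A B using pos by (simp add: field_simps power2_eq_square)
  also have "\<dots> = sin C"
    unfolding C using pos by (simp add: field_simps power2_eq_square)
  finally have sin: "sin (A + B) = sin C" .
  have "0 < sin C" using C(1,2) by (rule sin_gt_zero)
  \<comment> \<open>Were \<open>A + B\<close> between pi and 2 pi, its sine could not equal the
    positive \<open>sin C\<close>. This puts \<open>A + B\<close> where the cosine is
    injective.\<close>
  have AB: "A + B < pi"
  proof (rule ccontr)
    assume "\<not> A + B < pi"
    then have "0 \<le> sin (A + B - pi)"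
      using A(2) B(2) by (intro sin_ge_zero) auto
    with sin \<open>0 < sin C\<close> show False by (simp add: sin_diff)
  qed
  have "cos (A + B) = ((- x\<^sup>2 + y\<^sup>2 + z\<^sup>2) * (x\<^sup>2 - y\<^sup>2 + z\<^sup>2) - (sqrt E)\<^sup>2) / (4 * x * y * z\<^sup>2)"
    unfolding cos_add A B using pos by (simp add: field_simps power2_eq_square)
  also have "\<dots> = - ((x\<^sup>2 + y\<^sup>2 - z\<^sup>2) * (2 * z\<^sup>2)) / (4 * x * y * z\<^sup>2)"
    unfolding sE unfolding E_def by (rule arg_cong[of _ _ "\<lambda>t. t / _"]) algebra
  also have "\<dots> = cos (pi - C)"
    unfolding cos_pi_minus C using pos by (simp add: field_simps power2_eq_square)
  finally have cos: "cos (A + B) = cos (pi - C)" .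
  have "A + B = pi - C"
    by (rule cos_inj_pi[OF _ _ _ _ cos]) (use A(1) B(1) C(1,2) AB in linarith)+
  then show "A + B + C = pi" by simp
  show "\<exists>e>0. x = e * sin A \<and> y = e * sin B \<and> z = e * sin C"
  proof (intro exI conjI)
    \<comment> \<open>The diameter of the circumscribed circle.\<close>
    show "0 < 2 * x * y * z / sqrt E" using pos E by simp
  qed (use pos E in \<open>simp_all add: A B C\<close>)
qed

definition angle_volume :: "real \<Rightarrow> real \<Rightarrow> real \<Rightarrow> real" where
  "angle_volume r s t = lobachevsky (arccos ((- r\<^sup>2 + s\<^sup>2 + t\<^sup>2) / (2 * s * t))) +
    lobachevsky (arccos ((r\<^sup>2 - s\<^sup>2 + t\<^sup>2) / (2 * r * t))) +
    lobachevsky (arccos ((r\<^sup>2 + s\<^sup>2 - t\<^sup>2) / (2 * r * s)))"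

lemma angle_volume_commute: "angle_volume r s t = angle_volume s r t" "angle_volume r s t = angle_volume r t s"
proof -
  have e: "(- r\<^sup>2 + s\<^sup>2 + t\<^sup>2) / (2 * s * t) = (s\<^sup>2 - r\<^sup>2 + t\<^sup>2) / (2 * s * t)"
    "(r\<^sup>2 - s\<^sup>2 + t\<^sup>2) / (2 * r * t) = (- s\<^sup>2 + r\<^sup>2 + t\<^sup>2) / (2 * r * t)"
    "(r\<^sup>2 + s\<^sup>2 - t\<^sup>2) / (2 * r * s) = (s\<^sup>2 + r\<^sup>2 - t\<^sup>2) / (2 * s * r)"
    by (simp_all add: ac_simps)
  show "angle_volume r s t = angle_volume s r t"
    unfolding angle_volume_def e by (simp only: ac_simps)
  have e: "(- r\<^sup>2 + s\<^sup>2 + t\<^sup>2) / (2 * s * t) = (- r\<^sup>2 + t\<^sup>2 + s\<^sup>2) / (2 * t * s)"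
    "(r\<^sup>2 - s\<^sup>2 + t\<^sup>2) / (2 * r * t) = (r\<^sup>2 + t\<^sup>2 - s\<^sup>2) / (2 * r * t)"
    "(r\<^sup>2 + s\<^sup>2 - t\<^sup>2) / (2 * r * s) = (r\<^sup>2 - t\<^sup>2 + s\<^sup>2) / (2 * r * s)"
    by (simp_all add: ac_simps)
  show "angle_volume r s t = angle_volume r t s"
    unfolding angle_volume_def e by (simp only: ac_simps)
qed

text \<open>The three cosines are -1, 1 and 1, so the angles are pi, 0 and 0, where \<Lambda>
  vanishes.\<close>

lemma angle_volume_degenerate:
  assumes "0 < s" "0 < t"
  shows "angle_volume (s + t) s t = 0"
proof -
  have "- (s + t)\<^sup>2 + s\<^sup>2 + t\<^sup>2 = - (2 * s * t)" "(s + t)\<^sup>2 - s\<^sup>2 + t\<^sup>2 = 2 * (s + t) * t"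
    "(s + t)\<^sup>2 + s\<^sup>2 - t\<^sup>2 = 2 * (s + t) * s"
    by algebra+
  moreover have "2 * s * t \<noteq> 0" "2 * (s + t) * t \<noteq> 0" "2 * (s + t) * s \<noteq> 0"
    using assms by auto
  ultimately have e: "(- (s + t)\<^sup>2 + s\<^sup>2 + t\<^sup>2) / (2 * s * t) = -1"
    "((s + t)\<^sup>2 - s\<^sup>2 + t\<^sup>2) / (2 * (s + t) * t) = 1"
    "((s + t)\<^sup>2 + s\<^sup>2 - t\<^sup>2) / (2 * (s + t) * s) = 1"
    by (simp_all only: minus_divide_left[symmetric] divide_self simp_thms)
  show ?thesis
    unfolding angle_volume_def e by simp
qed

text \<open>The symmetric group permutes \<open>(x, y, z)\<close> by reflections and rotations by \<open>2\<pi>/3\<close> in the \<open>(c, d)\<close> plane.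
  The sorted triple lies in the sector of polar angle between \<open>0\<close> and \<open>\<pi>/3\<close>, where the angle is
  recovered from the invariant \<open>cos 3\<kappa>\<close>.\<close>

lemma sorted_coordinates:
  fixes x y z \<alpha> \<omega> :: real
  assumes sorted: "x \<le> y" "y \<le> z" and sum: "x + y + z = 1"
    and \<alpha>: "\<alpha> = - ((x + y + z) * (y + z - x) * (z + x - y) * (x + y - z))"
    and \<omega>: "\<omega> = x\<^sup>2 + y\<^sup>2 + z\<^sup>2"
  defines "\<kappa> \<equiv> arccos ((- 27 * \<alpha> + 18 * \<omega> - 7) / (4 * sqrt 2 * (3 * \<omega> - 1) powr (3/2))) / 3"
  shows "(if (\<alpha>, \<omega>) = (- 1/27, 1/3) then (0, 0)
      else (sqrt (2 * \<omega> - 2/3) * sin \<kappa>, sqrt (2 * \<omega> - 2/3) * cos \<kappa>)) = (z - y, (1 - 3 * x) / sqrt 3)"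
proof -
  define c d where "c = z - y" and "d = (1 - 3 * x) / sqrt 3"
  define R where "R = sqrt (2 * \<omega> - 2/3)"
  have z: "z = 1 - x - y" using sum by simp
  have s3: "sqrt 3 * sqrt 3 = 3" by simp
  have d: "sqrt 3 * d = 1 - 3 * x" by (simp add: d_def)
  have d2: "3 * d\<^sup>2 = (1 - 3 * x)\<^sup>2"
    using d s3 by algebra
  have cd: "c\<^sup>2 + d\<^sup>2 = 2 * \<omega> - 2/3"
  proof -
    have "3 * (c\<^sup>2 + d\<^sup>2) = 3 * (2 * \<omega> - 2/3)"
      unfolding distrib_left d2 c_def \<omega> z by (simp add: power2_eq_square algebra_simps)
    then show ?thesis by simp
  qed
  have c0: "0 \<le> c" using sorted by (simp add: c_def)
  have d0: "0 \<le> d" unfolding d_def using sorted sum by simp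
  have R2: "R\<^sup>2 = c\<^sup>2 + d\<^sup>2" unfolding R_def by (simp add: cd[symmetric])
  have R0: "0 \<le> R" by (simp add: R_def cd[symmetric])
  show ?thesis
  proof (cases "R = 0")
    case True
    then have "c = 0" "d = 0" using R2 by (simp_all add: sum_power2_eq_zero_iff)
    \<comment> \<open>For \<open>R = 0\<close> both branches of the conditional give the
      origin.\<close>
    moreover have "(if (\<alpha>, \<omega>) = (- 1/27, 1/3) then (0, 0)
      else (sqrt (2 * \<omega> - 2/3) * sin \<kappa>, sqrt (2 * \<omega> - 2/3) * cos \<kappa>)) = (0, 0)"
      using True unfolding R_def by simp
    ultimately show ?thesis by (simp add: c_def d_def)
  next
    case False
    with R0 have R: "0 < R" by simp
    have "\<omega> \<noteq> 1/3"
    proof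
      assume "\<omega> = 1/3"
      then have "R = 0" by (simp add: R_def)
      with R show False by simp
    qed
    define k where "k = arccos (d / R)"
    have dR: "d \<le> R"
      by (rule power2_le_imp_le[OF _ R0]) (simp add: R2)
    have q01: "0 \<le> d / R" "d / R \<le> 1"
      using d0 dR R by simp_all
    have k: "cos k = d / R" "0 \<le> k"
      using q01 by (simp_all add: k_def arccos_lbound)
    have "sin k = sqrt (1 - (d / R)\<^sup>2)"
      unfolding k_def using q01 by (intro sin_arccos) simp_all
    also have "1 - (d / R)\<^sup>2 = (c / R)\<^sup>2"
    proof -
      have "c\<^sup>2 = R\<^sup>2 - d\<^sup>2" using R2 by simp
      then show ?thesis using R by (simp add: power_divide diff_divide_distrib)
    qed
    finally have sk: "sin k = c / R" using c0 R by simp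
    \<comment> \<open>The ordering \<open>x \<le> y\<close> reads \<open>c \<le> sqrt 3 * d\<close>.
      It bounds the polar angle \<open>k\<close> by pi/3, so that \<open>arccos\<close> recovers
      \<open>3 * k\<close> from its cosine.\<close>
    have "R \<le> 2 * d"
    proof (rule power2_le_imp_le)
      have "c \<le> sqrt 3 * d"
        unfolding d c_def using sorted sum by simp
      then have "c\<^sup>2 \<le> (sqrt 3 * d)\<^sup>2"
        using c0 by (intro power_mono)
      then show "R\<^sup>2 \<le> (2 * d)\<^sup>2"
        by (simp add: R2 power_mult_distrib)
    qed (use d0 in simp)
    then have "1 / 2 \<le> d / R" using R by (simp add: field_simps)
    then have "k \<le> arccos (1 / 2)"
      unfolding k_def using q01 by (intro arccos_le_arccos) simp_all
    also have "arccos (1 / 2) = pi / 3"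
      by (rule arccos_unique) (simp_all add: cos_60)
    finally have k3: "k \<le> pi / 3" .
    define q where "q = sqrt (3 * \<omega> - 1)"
    have w: "0 < 3 * \<omega> - 1"
      using R by (simp add: R_def)
    have "(3 * \<omega> - 1) powr (3/2) = ((3 * \<omega> - 1) powr (1/2)) powr 3"
      by (simp add: powr_powr)
    also have "\<dots> = q ^ 3"
      using w by (simp add: powr_half_sqrt q_def)
    finally have q: "(3 * \<omega> - 1) powr (3/2) = q ^ 3" .
    have q0: "0 < q" using w by (simp add: q_def)
    have Rq: "sqrt 3 * R = sqrt 2 * q"
      unfolding R_def q_def real_sqrt_mult[symmetric] by simp
    \<comment> \<open>Since \<open>1 - 3 * x = sqrt 3 * R * cos k\<close>, this cubic in
      \<open>1 - 3 * x\<close> is a multiple of the triple angle polynomial in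
      \<open>cos k\<close>.\<close>
    have "- 27 * \<alpha> + 18 * \<omega> - 7 = 8 * (1 - 3 * x) ^ 3 - 18 * (1 - 3 * x) * R\<^sup>2"
      unfolding R2 cd \<omega> \<alpha> z by algebra
    also have "\<dots> = (4 * (cos k) ^ 3 - 3 * cos k) * (6 * sqrt 3 * R ^ 3)"
    proof -
      have "d = cos k * R" using k R by simp
      then have x: "1 - 3 * x = sqrt 3 * (cos k * R)" using d by simp
      have "(sqrt 3) ^ 3 = 3 * sqrt 3" by (simp add: power3_eq_cube)
      then show ?thesis unfolding x by (simp add: power_mult_distrib algebra_simps power2_eq_square power3_eq_cube)
    qed
    also have "6 * sqrt 3 * R ^ 3 = 4 * sqrt 2 * q ^ 3"
    proof -
      have "(sqrt 3 * R) ^ 3 = (sqrt 2 * q) ^ 3" by (simp only: Rq)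
      moreover have "(sqrt 3) ^ 3 = 3 * sqrt 3" "(sqrt 2) ^ 3 = 2 * sqrt 2"
        by (simp_all add: power3_eq_cube)
      ultimately show ?thesis by (simp add: power_mult_distrib)
    qed
    finally have "(- 27 * \<alpha> + 18 * \<omega> - 7) / (4 * sqrt 2 * (3 * \<omega> - 1) powr (3/2)) = cos (3 * k)"
      unfolding q cos_treble_cos using q0 by simp
    then have "\<kappa> = k"
      unfolding \<kappa>_def using k(2) k3 by (simp add: arccos_cos)
    then have "(sqrt (2 * \<omega> - 2/3) * sin \<kappa>, sqrt (2 * \<omega> - 2/3) * cos \<kappa>) = (c, d)"
      using R by (simp add: R_def[symmetric] k sk)
    then show ?thesis
      using \<open>\<omega> \<noteq> 1/3\<close> by (simp add: c_def d_def)
  qed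
qed

section \<open>The volume as a function of determinant and permanent\<close>

text \<open>When a side vanishes, the quotients in \<open>angle_volume\<close> have zero
  denominators; this is the exceptional case of the theorem.\<close>

definition gram_volume :: "real \<Rightarrow> real \<Rightarrow> real \<Rightarrow> real" where
  "gram_volume x y z = (if x * y * z = 0 then 0 else angle_volume x y z)"

lemma gram_volume_commute: "gram_volume x y z = gram_volume y x z" "gram_volume x y z = gram_volume x z y"
  using angle_volume_commute[of x y z] by (auto simp: gram_volume_def)

lemma Delta_nonneg:
  assumes "(x, y, z) \<in> Delta"
  shows "0 \<le> x" "0 \<le> y" "0 \<le> z"
  using assms by (auto simp: Delta_def)

lemma gram_volume_degenerate:
  assumes T: "(x, y, z) \<in> Delta" and "det (gram (x, y, z)) = 0"
  shows "gram_volume x y z = 0"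
proof (cases "x * y * z = 0")
  case False
  with Delta_nonneg[OF T] have pos: "0 < x" "0 < y" "0 < z" by auto
  have "x + y + z = 1" using T by (simp add: Delta_def)
  then have "x = y + z \<or> y = x + z \<or> z = y + x"
    using assms(2) unfolding det_gram by auto
  then show ?thesis
  proof (elim disjE)
    assume "x = y + z"
    with pos show ?thesis
      using angle_volume_degenerate[of y z] by (simp add: gram_volume_def)
  next
    assume "y = x + z"
    with pos show ?thesis
      using angle_volume_degenerate[of x z] angle_volume_commute(1)[of x "x + z" z]
      by (simp add: gram_volume_def)
  next
    assume "z = y + x"
    with pos show ?thesis
      using angle_volume_degenerate[of y x] angle_volume_commute(2)[of x y "y + x"]
        angle_volume_commute(1)[of x "y + x" y] angle_volume_commute(2)[of "y + x" x y]
      by (simp add: gram_volume_def)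
  qed
qed (simp add: gram_volume_def)

text \<open>A product of opposite Gram entries contains every scalar \<open>k i\<close> once, so the
  products of the \<open>h i j\<close> are \<open>x^2\<close>, \<open>y^2\<close>,
  \<open>z^2\<close> up to the common factor \<open>\<rho>\<close>. A zero determinant means a flat
  hull of measure zero; otherwise \<open>x\<close>, \<open>y\<close>, \<open>z\<close> are the sides
  of a genuine triangle.\<close>

lemma volume_in_frame_represents:
  fixes B :: "'v::real_vector \<Rightarrow> 'v \<Rightarrow> real"
  assumes bilinear: "bilinear B" and sym: "\<And>u w. B u w = B w u" and frame: "orthonormal_frame B f n"
    and T: "(x, y, z) \<in> Delta" and v: "represents B (x, y, z) v"
  shows "volume_in_frame B f n v = gram_volume x y z"
proof -
  have diag: "gram (x, y, z) $ i $ i = 0" for i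
    using exhaust_4[of i] by auto
  have "ideal_tetrahedron B v" "is_gram_matrix B v (gram (x, y, z))"
    using v by (simp_all add: represents_def)
  then obtain X k where X: "\<And>i. X i \<bullet> X i = 1" and k: "\<And>i. k i \<noteq> (0::real)"
    and G: "\<And>i j. gram (x, y, z) $ i $ j = k i * k j * (1 - X i \<bullet> X j)"
    and chart: "{w. \<exists>i. klein_chart f n w \<in> v i} = range X"
    by (rule ideal_tetrahedron_chart[OF bilinear sym frame _ _ diag]) (rule that)
  define h where "h i j = 1 - X i \<bullet> X j" for i j
  define \<rho> where "\<rho> = 1 / (k 1 * k 2 * k 3 * k 4)"
  have K: "\<rho> * (k 1 * k 2 * k 3 * k 4) = 1"
    using k by (simp add: \<rho>_def)
  have g: "x = k 1 * k 2 * h 1 2" "x = k 3 * k 4 * h 3 4" "y = k 1 * k 3 * h 1 3"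
    "y = k 2 * k 4 * h 2 4" "z = k 1 * k 4 * h 1 4" "z = k 2 * k 3 * h 2 3"
    using G[of 1 2] G[of 3 4] G[of 1 3] G[of 2 4] G[of 1 4] G[of 2 3] by (simp_all add: h_def)
  have "h 1 2 * h 3 4 = \<rho> * ((k 1 * k 2 * h 1 2) * (k 3 * k 4 * h 3 4))"
    "h 1 3 * h 2 4 = \<rho> * ((k 1 * k 3 * h 1 3) * (k 2 * k 4 * h 2 4))"
    "h 1 4 * h 2 3 = \<rho> * ((k 1 * k 4 * h 1 4) * (k 2 * k 3 * h 2 3))"
    using K by algebra+
  then have prods: "h 1 2 * h 3 4 = \<rho> * x\<^sup>2" "h 1 3 * h 2 4 = \<rho> * y\<^sup>2" "h 1 4 * h 2 3 = \<rho> * z\<^sup>2"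
    by (simp_all only: g[symmetric] power2_eq_square)
  have hull_borel: "convex hull (range X) \<in> sets borel"
    by (intro borel_closed compact_imp_closed finite_imp_compact_convex_hull) simp
  have vol: "volume_in_frame B f n v = enn2real (\<integral>\<^sup>+w. ennreal (klein_density w) *
      indicator (convex hull (range X)) w \<partial>lborel)"
    using volume_in_frame_eq[OF bilinear sym frame, of v] hull_borel by (simp add: chart)
  have sum: "x + y + z = 1" and le: "x \<le> y + z" "y \<le> z + x" "z \<le> x + y"
    using T by (simp_all add: Delta_def)
  show ?thesis
  proof (cases "det (gram (x, y, z)) = 0")
    case True
    have "(det (edge_matrix X))\<^sup>2 = - \<rho>\<^sup>2 * det (gram (x, y, z))"
      unfolding det_gram det_edge_matrix_squared[of X, OF X, folded h_def] prods by algebra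
    then have "det (edge_matrix X) = 0"
      using True by simp
    then have "negligible (convex hull (range X))"
      using negligible_convex_hull_singular[of "edge_matrix X" "X 4"]
      by (simp only: hull_edge_matrix)
    then have "convex hull (range X) \<in> null_sets lborel"
      using hull_borel by (simp add: negligible_iff_null_sets null_sets_completion_iff)
    then have "AE w in lborel. w \<notin> convex hull (range X)"
      by (rule AE_not_in)
    then have "(\<integral>\<^sup>+w. ennreal (klein_density w) * indicator (convex hull (range X)) w \<partial>lborel) =
        (\<integral>\<^sup>+w. 0 \<partial>(lborel :: (real^3) measure))"
      by (intro nn_integral_cong_AE) (auto elim: eventually_mono)
    then show ?thesis
      using gram_volume_degenerate[OF T True] vol by simp
  next
    case False
    then have strict: "x < y + z" "y < z + x" "z < x + y"
      using le unfolding det_gram by (auto simp: le_less)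
    then have pos: "0 < x" "0 < y" "0 < z" by linarith+
    define A B' C where "A = arccos ((- x\<^sup>2 + y\<^sup>2 + z\<^sup>2) / (2 * y * z))"
      and "B' = arccos ((x\<^sup>2 - y\<^sup>2 + z\<^sup>2) / (2 * x * z))"
      and "C = arccos ((x\<^sup>2 + y\<^sup>2 - z\<^sup>2) / (2 * x * y))"
    note tri = triangle_angles[OF pos strict, folded A_def B'_def C_def]
    obtain e where e: "0 < e" "x = e * sin A" "y = e * sin B'" "z = e * sin C"
      using tri(5) by blast
    have "0 \<le> h i j" for i j
      using norm_cauchy_schwarz[of "X i" "X j"] X by (simp add: h_def norm_eq_sqrt_inner)
    \<comment> \<open>The signs of the \<open>k i\<close> are unknown, so the sign of
      \<open>\<rho>\<close> is read off from a product of nonnegative entries.\<close>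
    then have "0 \<le> \<rho> * x\<^sup>2"
      unfolding prods(1)[symmetric] by simp
    moreover have "\<rho> \<noteq> 0" using k by (simp add: \<rho>_def)
    ultimately have \<rho>: "0 < \<rho>"
      using pos by (simp add: zero_le_mult_iff)
    have "(\<integral>\<^sup>+w. ennreal (klein_density w) * indicator (convex hull (range X)) w \<partial>lborel) =
        ennreal (lobachevsky A + lobachevsky B' + lobachevsky C)"
    proof (rule nn_integral_klein_density_tetrahedron[OF X tri(1-4)])
      show "0 < \<rho> * e\<^sup>2" using \<rho> e(1) by simp
    qed (use prods e in \<open>simp_all add: h_def power_mult_distrib mult.assoc\<close>)
    then show ?thesis
      using vol lobachevsky_sum_nonneg[OF tri(1-4)] pos
      by (simp add: gram_volume_def angle_volume_def A_def B'_def C_def)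
  qed
qed

text \<open>Each definite description needs an admissible choice besides a common value: a frame for
  the inner one, a representing tetrahedron for the outer one.\<close>

lemma class_volume_eq:
  fixes B :: "'v::real_vector \<Rightarrow> 'v \<Rightarrow> real"
  assumes "lorentzian_form B" and T: "(x, y, z) \<in> Delta"
  shows "class_volume B (x, y, z) = gram_volume x y z"
proof -
  obtain f n where B: "bilinear B" "\<And>u w. B u w = B w u" and frame: "orthonormal_frame B f n"
    using assms(1) unfolding lorentzian_form_def by blast
  have tv: "tetrahedron_volume B v = gram_volume x y z" if v: "represents B (x, y, z) v" for v
    unfolding tetrahedron_volume_def
    by (rule the_equality)
      (use volume_in_frame_represents[OF B _ T v] frame in metis)+
  obtain v where v: "represents B (x, y, z) v"
    using represents_exists[OF B frame T] by blast
  show ?thesis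
    unfolding class_volume_def
    by (rule the_equality) (use tv v in metis)+
qed

text \<open>All the data are invariant under the two adjacent swaps, which generate the permutations
  of the triple.\<close>

lemma Delta_sort:
  assumes "(x, y, z) \<in> Delta"
  obtains a b c where "(a, b, c) \<in> Delta" "a \<le> b" "b \<le> c" "gram_volume a b c = gram_volume x y z"
    "det (gram (a, b, c)) = det (gram (x, y, z))" "permanent (gram (a, b, c)) = permanent (gram (x, y, z))"
proof -
  define same where "same a b c \<longleftrightarrow> (a, b, c) \<in> Delta \<and> gram_volume a b c = gram_volume x y z \<and>
    det (gram (a, b, c)) = det (gram (x, y, z)) \<and> permanent (gram (a, b, c)) = permanent (gram (x, y, z))"
    for a b c
  have det: "det (gram (b, a, c)) = det (gram (a, b, c))" "det (gram (a, c, b)) = det (gram (a, b, c))" for a b c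
    unfolding det_gram by algebra+
  have per: "permanent (gram (b, a, c)) = permanent (gram (a, b, c))"
    "permanent (gram (a, c, b)) = permanent (gram (a, b, c))" for a b c
    unfolding permanent_gram by (simp_all add: add_ac)
  have Delta: "(b, a, c) \<in> Delta \<longleftrightarrow> (a, b, c) \<in> Delta" "(a, c, b) \<in> Delta \<longleftrightarrow> (a, b, c) \<in> Delta" for a b c
    by (auto simp: Delta_def)
  have s1: "same b a c" if "same a b c" for a b c
    using that gram_volume_commute(1)[of a b c] unfolding same_def det(1)[of b a c] per(1)[of b a c] Delta(1)[of b a c]
    by (simp only:)
  have s2: "same a c b" if "same a b c" for a b c
    using that gram_volume_commute(2)[of a b c] unfolding same_def det(2)[of a c b] per(2)[of a c b] Delta(2)[of a c b]
    by (simp only:)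
  have "same x y z" using assms by (simp add: same_def)
  then have "\<exists>a b c. same a b c \<and> a \<le> b \<and> b \<le> c"
    using s1 s2 by (metis linear)
  then show ?thesis
    using that unfolding same_def by blast
qed

text \<open>A zero determinant makes one side 1/2 and the others sum to 1/2; then the sum of squares
  is 1/2 only if the product of those two is 0. Conversely, a zero side forces the other two to be
  1/2.\<close>

lemma det_gram_0_permanent_iff:
  assumes T: "(x, y, z) \<in> Delta"
  shows "det (gram (x, y, z)) = 0 \<and> sqrt (permanent (gram (x, y, z))) = 1/2 \<longleftrightarrow> x * y * z = 0"
proof -
  have sum: "x + y + z = 1" and le: "x \<le> y + z" "y \<le> z + x" "z \<le> x + y"
    using T by (simp_all add: Delta_def)
  have per: "sqrt (permanent (gram (x, y, z))) = x\<^sup>2 + y\<^sup>2 + z\<^sup>2"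
    unfolding permanent_gram by simp
  show ?thesis
  proof
    assume "det (gram (x, y, z)) = 0 \<and> sqrt (permanent (gram (x, y, z))) = 1/2"
    then have "x = y + z \<or> y = z + x \<or> z = x + y" and w: "x\<^sup>2 + y\<^sup>2 + z\<^sup>2 = 1/2"
      unfolding det_gram per using sum by auto
    then consider "x = 1/2" "z = 1/2 - y" | "y = 1/2" "z = 1/2 - x" | "z = 1/2" "y = 1/2 - x"
      using sum by force
    then show "x * y * z = 0"
      using w by cases (auto simp: power2_eq_square algebra_simps)
  next
    assume "x * y * z = 0"
    then consider "x = 0" "y = 1/2" "z = 1/2" | "y = 0" "x = 1/2" "z = 1/2" | "z = 0" "x = 1/2" "y = 1/2"
      using sum le by force
    then show "det (gram (x, y, z)) = 0 \<and> sqrt (permanent (gram (x, y, z))) = 1/2"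
    proof cases
      case 1
      show ?thesis unfolding det_gram per unfolding 1 by (simp add: power2_eq_square)
    next
      case 2
      show ?thesis unfolding det_gram per unfolding 2 by (simp add: power2_eq_square)
    next
      case 3
      show ?thesis unfolding det_gram per unfolding 3 by (simp add: power2_eq_square)
    qed
  qed
qed

theorem theorem5p1:
  fixes B :: "'v::real_vector \<Rightarrow> 'v \<Rightarrow> real" and \<alpha> \<omega> :: real
  assumes "lorentzian_form B" and "(\<alpha>, \<omega>) \<in> S"
  shows "vol B \<alpha> \<omega> =
    (let
       \<kappa> = arccos ((- 27 * \<alpha> + 18 * \<omega> - 7) / (4 * sqrt 2 * (3 * \<omega> - 1) powr (3/2))) / 3;
       (c, d) = (if (\<alpha>, \<omega>) = (- 1/27, 1/3) then (0, 0)
                 else (sqrt (2 * \<omega> - 2/3) * sin \<kappa>, sqrt (2 * \<omega> - 2/3) * cos \<kappa>));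
       (r, s, t) = ((1 - sqrt 3 * d) / 3,
                    (2 - 3 * c + sqrt 3 * d) / 6,
                    (2 + 3 * c + sqrt 3 * d) / 6);
       \<theta>1 = arccos ((- r\<^sup>2 + s\<^sup>2 + t\<^sup>2) / (2 * s * t));
       \<theta>2 = arccos ((r\<^sup>2 - s\<^sup>2 + t\<^sup>2) / (2 * r * t));
       \<theta>3 = arccos ((r\<^sup>2 + s\<^sup>2 - t\<^sup>2) / (2 * r * s))
     in if (\<alpha>, \<omega>) = (0, 1/2) then 0
        else lobachevsky \<theta>1 + lobachevsky \<theta>2 + lobachevsky \<theta>3)"
    (is "_ = ?V")
proof -
  have V: "class_volume B T = ?V"
    if T: "T \<in> Delta" and \<alpha>: "det (gram T) = \<alpha>" and \<omega>: "sqrt (permanent (gram T)) = \<omega>" for T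
  proof -
    obtain x y z where xyz: "T = (x, y, z)" by (cases T)
    obtain a b c where abc: "(a, b, c) \<in> Delta" "a \<le> b" "b \<le> c"
      and same: "gram_volume a b c = gram_volume x y z"
        "det (gram (a, b, c)) = det (gram (x, y, z))"
        "permanent (gram (a, b, c)) = permanent (gram (x, y, z))"
      using Delta_sort T unfolding xyz by metis
    have sum: "a + b + c = 1" using abc by (simp add: Delta_def)
    have \<alpha>': "\<alpha> = det (gram (a, b, c))" and \<omega>': "\<omega> = sqrt (permanent (gram (a, b, c)))"
      using \<alpha> \<omega> same by (simp_all add: xyz)
    have \<alpha>'': "\<alpha> = - ((a + b + c) * (b + c - a) * (c + a - b) * (a + b - c))"
      unfolding \<alpha>' det_gram ..
    have \<omega>'': "\<omega> = a\<^sup>2 + b\<^sup>2 + c\<^sup>2"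
      unfolding \<omega>' permanent_gram by simp
    have zero: "(\<alpha>, \<omega>) = (0, 1/2) \<longleftrightarrow> a * b * c = 0"
      using det_gram_0_permanent_iff[OF abc(1)] by (simp add: \<alpha>' \<omega>')
    \<comment> \<open>The formulas for \<open>r\<close>, \<open>s\<close>, \<open>t\<close> invert
      the linear change to the coordinates \<open>(c, d)\<close> on the plane where the sum is
      1.\<close>
    have rst: "(1 - sqrt 3 * ((1 - 3 * a) / sqrt 3)) / 3 = a"
      "(2 - 3 * (c - b) + sqrt 3 * ((1 - 3 * a) / sqrt 3)) / 6 = b"
      "(2 + 3 * (c - b) + sqrt 3 * ((1 - 3 * a) / sqrt 3)) / 6 = c"
      using sum by simp_all
    have "?V = gram_volume a b c"
      unfolding Let_def sorted_coordinates[OF abc(2,3) sum \<alpha>'' \<omega>''] prod.case rst zero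
      by (simp only: gram_volume_def angle_volume_def)
    also have "\<dots> = class_volume B T"
      using class_volume_eq[OF assms(1)] T by (simp add: same xyz)
    finally show ?thesis ..
  qed
  \<comment> \<open>Membership in \<open>S\<close> supplies a point of \<open>Delta\<close>, so the
    description in \<open>vol\<close> is not vacuous.\<close>
  obtain T where "T \<in> Delta" "det (gram T) = \<alpha>" "sqrt (permanent (gram T)) = \<omega>"
    using assms(2) by (auto simp: S_def)
  with V show ?thesis
    unfolding vol_def by (intro the_equality) blast+
qed

end
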